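(* Let $R$ be a ring, let $\mathcal C$ be a full subcategory of $\operatorname{Mod-}R$ all of whose objects are indecomposable slender right $R$-modules, and let $\mathcal P,\mathcal Q$ be completely prime ideals of $\mathcal C$ such that for every $A\in\operatorname{Ob}(\mathcal C)$ an endomorphism $f\colon A\to A$ is an automorphism if and only if $f\notin\mathcal P(A,A)\cup\mathcal Q(A,A)$. Assume $\mathcal C$ satisfies Condition (DSP). Let $\{A_i\mid i\in I\}$ and $\{B_j\mid j\in J\}$ be families of objects of $\mathcal C$ with $|I|$ and $|J|$ non-measurable cardinals. Assume: (a) in each of the two families, each $\mathcal P$ class contains at most countably many members; (b) in each of the two families, each $\mathcal Q$ class contains at most countably many members; (c) $\prod_{i\in I}A_i\cong\prod_{j\in J}B_j$. Then there exist bijections $\sigma,\tau\colon I\to J$ with $[A_i]_{\mathcal P}=[B_{\sigma(i)}]_{\mathcal P}$ and $[A_i]_{\mathcal Q}=[B_{\tau(i)}]_{\mathcal Q}$ for every $i\in I$.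
   Context: A completely prime ideal $\mathcal P$ of a full subcategory $\mathcal C$ of $\operatorname{Mod-}R$ consists of a subgroup $\mathcal P(A,B)$ of $\operatorname{Hom}_R(A,B)$ for each pair of objects $A,B$ of $\mathcal C$ such that: (1) for all objects $A,B,C$ and morphisms $f\colon A\to B$, $g\colon B\to C$, one has $gf\in\mathcal P(A,C)$ if and only if $f\in\mathcal P(A,B)$ or $g\in\mathcal P(B,C)$; (2) $\mathcal P(A,A)\neq\operatorname{Hom}_R(A,A)$ for every object $A$. For objects $A,B$, write $[A]_{\mathcal P}=[B]_{\mathcal P}$ ("same $\mathcal P$ class") if $\mathcal P(A,B)\ne\operatorname{Hom}_R(A,B)$ and $\mathcal P(B,A)\neq\operatorname{Hom}_R(B,A)$. $\mathcal C$ satisfies Condition (DSP) if whenever $A,B,C,D$ are right $R$-modules with $A\oplus B\cong C\oplus D$ and $A,B,C\in\operatorname{Ob}(\mathcal C)$, then $D\in\operatorname{Ob}(\mathcal C)$. A right $R$-module $M$ is slender if for every homomorphism $f\colon R^\omega=\prod_{n<\omega}e_nR\to M$ (with $e_n$ the element having $1$ in position $n$ and $0$ elsewhere) there is $n_0$ with $f(e_n)=0$ for all $n\ge n_0$. *)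

theory Defs
  imports "HOL-Algebra.Ring" "HOL-Library.Countable_Set"
begin

record ('a, 'r) rmod = "'a partial_object" +
  radd :: "'a \<Rightarrow> 'a \<Rightarrow> 'a"
  rzero :: 'a
  rsmult :: "'a \<Rightarrow> 'r \<Rightarrow> 'a"

definition right_module :: "'r ring \<Rightarrow> ('a, 'r) rmod \<Rightarrow> bool" where
  "right_module R M \<longleftrightarrow> ring R \<and>
     rzero M \<in> carrier M \<and>
     (\<forall>x\<in>carrier M. \<forall>y\<in>carrier M. radd M x y \<in> carrier M) \<and>
     (\<forall>x\<in>carrier M. \<forall>y\<in>carrier M. \<forall>z\<in>carrier M.
        radd M (radd M x y) z = radd M x (radd M y z)) \<and>
     (\<forall>x\<in>carrier M. \<forall>y\<in>carrier M. radd M x y = radd M y x) \<and>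
     (\<forall>x\<in>carrier M. radd M (rzero M) x = x) \<and>
     (\<forall>x\<in>carrier M. \<exists>y\<in>carrier M. radd M x y = rzero M) \<and>
     (\<forall>x\<in>carrier M. \<forall>r\<in>carrier R. rsmult M x r \<in> carrier M) \<and>
     (\<forall>x\<in>carrier M. \<forall>r\<in>carrier R. \<forall>s\<in>carrier R.
        rsmult M x (r \<oplus>\<^bsub>R\<^esub> s) = radd M (rsmult M x r) (rsmult M x s)) \<and>
     (\<forall>x\<in>carrier M. \<forall>y\<in>carrier M. \<forall>r\<in>carrier R.
        rsmult M (radd M x y) r = radd M (rsmult M x r) (rsmult M y r)) \<and>
     (\<forall>x\<in>carrier M. \<forall>r\<in>carrier R. \<forall>s\<in>carrier R.
        rsmult M x (r \<otimes>\<^bsub>R\<^esub> s) = rsmult M (rsmult M x r) s) \<and>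
     (\<forall>x\<in>carrier M. rsmult M x \<one>\<^bsub>R\<^esub> = x)"

definition rhom :: "'r ring \<Rightarrow> ('a, 'r) rmod \<Rightarrow> ('b, 'r) rmod \<Rightarrow> ('a \<Rightarrow> 'b) set" where
  "rhom R M N = {f. f \<in> carrier M \<rightarrow>\<^sub>E carrier N \<and>
     (\<forall>x\<in>carrier M. \<forall>y\<in>carrier M. f (radd M x y) = radd N (f x) (f y)) \<and>
     (\<forall>x\<in>carrier M. \<forall>r\<in>carrier R. f (rsmult M x r) = rsmult N (f x) r)}"

definition rm_iso :: "'r ring \<Rightarrow> ('a, 'r) rmod \<Rightarrow> ('b, 'r) rmod \<Rightarrow> bool" where
  "rm_iso R M N \<longleftrightarrow> (\<exists>f\<in>rhom R M N. bij_betw f (carrier M) (carrier N))"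

definition rprod :: "'i set \<Rightarrow> ('i \<Rightarrow> ('a, 'r) rmod) \<Rightarrow> ('i \<Rightarrow> 'a, 'r) rmod" where
  "rprod I A = \<lparr>carrier = (\<Pi>\<^sub>E i\<in>I. carrier (A i)),
     radd = (\<lambda>x y. \<lambda>i\<in>I. radd (A i) (x i) (y i)),
     rzero = (\<lambda>i\<in>I. rzero (A i)),
     rsmult = (\<lambda>x r. \<lambda>i\<in>I. rsmult (A i) (x i) r)\<rparr>"

definition rdsum :: "('a, 'r) rmod \<Rightarrow> ('b, 'r) rmod \<Rightarrow> ('a \<times> 'b, 'r) rmod" where
  "rdsum M N = \<lparr>carrier = carrier M \<times> carrier N,
     radd = (\<lambda>(a, b) (c, d). (radd M a c, radd N b d)),
     rzero = (rzero M, rzero N),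
     rsmult = (\<lambda>(a, b) r. (rsmult M a r, rsmult N b r))\<rparr>"

definition ring_rmod :: "'r ring \<Rightarrow> ('r, 'r) rmod" where
  "ring_rmod R = \<lparr>carrier = carrier R, radd = add R, rzero = zero R, rsmult = mult R\<rparr>"

definition slender :: "'r ring \<Rightarrow> ('a, 'r) rmod \<Rightarrow> bool" where
  "slender R M \<longleftrightarrow>
     (\<forall>f\<in>rhom R (rprod (UNIV :: nat set) (\<lambda>_. ring_rmod R)) M.
        \<exists>n0. \<forall>n\<ge>n0. f (\<lambda>k. if k = n then \<one>\<^bsub>R\<^esub> else \<zero>\<^bsub>R\<^esub>) = rzero M)"

definition submodule :: "'r ring \<Rightarrow> ('a, 'r) rmod \<Rightarrow> 'a set \<Rightarrow> bool" where
  "submodule R M N \<longleftrightarrow> N \<subseteq> carrier M \<and> rzero M \<in> N \<and>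
     (\<forall>x\<in>N. \<forall>y\<in>N. radd M x y \<in> N) \<and>
     (\<forall>x\<in>N. \<forall>r\<in>carrier R. rsmult M x r \<in> N)"

definition indecomposable :: "'r ring \<Rightarrow> ('a, 'r) rmod \<Rightarrow> bool" where
  "indecomposable R M \<longleftrightarrow> carrier M \<noteq> {rzero M} \<and>
     (\<forall>N1 N2. submodule R M N1 \<and> submodule R M N2 \<and> N1 \<inter> N2 = {rzero M} \<and>
        {radd M x y | x y. x \<in> N1 \<and> y \<in> N2} = carrier M
        \<longrightarrow> N1 = {rzero M} \<or> N2 = {rzero M})"

definition hom_zero :: "('a, 'r) rmod \<Rightarrow> ('b, 'r) rmod \<Rightarrow> 'a \<Rightarrow> 'b" where
  "hom_zero M N = (\<lambda>x\<in>carrier M. rzero N)"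

definition hom_add :: "('a, 'r) rmod \<Rightarrow> ('b, 'r) rmod \<Rightarrow> ('a \<Rightarrow> 'b) \<Rightarrow> ('a \<Rightarrow> 'b) \<Rightarrow> 'a \<Rightarrow> 'b" where
  "hom_add M N f g = (\<lambda>x\<in>carrier M. radd N (f x) (g x))"

definition completely_prime ::
  "'r ring \<Rightarrow> ('a, 'r) rmod set \<Rightarrow> (('a, 'r) rmod \<Rightarrow> ('a, 'r) rmod \<Rightarrow> ('a \<Rightarrow> 'a) set) \<Rightarrow> bool" where
  "completely_prime R Ob P \<longleftrightarrow>
     (\<forall>A\<in>Ob. \<forall>B\<in>Ob. P A B \<subseteq> rhom R A B \<and> hom_zero A B \<in> P A B \<and>
        (\<forall>f\<in>P A B. \<forall>g\<in>P A B. hom_add A B f g \<in> P A B) \<and>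
        (\<forall>f\<in>P A B. \<exists>g\<in>P A B. hom_add A B f g = hom_zero A B)) \<and>
     (\<forall>A\<in>Ob. \<forall>B\<in>Ob. \<forall>C\<in>Ob. \<forall>f\<in>rhom R A B. \<forall>g\<in>rhom R B C.
        (compose (carrier A) g f \<in> P A C \<longleftrightarrow> f \<in> P A B \<or> g \<in> P B C)) \<and>
     (\<forall>A\<in>Ob. P A A \<noteq> rhom R A A)"

definition same_class ::
  "'r ring \<Rightarrow> (('a, 'r) rmod \<Rightarrow> ('a, 'r) rmod \<Rightarrow> ('a \<Rightarrow> 'a) set) \<Rightarrow> ('a, 'r) rmod \<Rightarrow> ('a, 'r) rmod \<Rightarrow> bool" where
  "same_class R P A B \<longleftrightarrow> P A B \<noteq> rhom R A B \<and> P B A \<noteq> rhom R B A"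

definition DSP :: "'r ring \<Rightarrow> ('a, 'r) rmod set \<Rightarrow> bool" where
  "DSP R Ob \<longleftrightarrow> (\<forall>A\<in>Ob. \<forall>B\<in>Ob. \<forall>C\<in>Ob. \<forall>D.
     right_module R D \<and> rm_iso R (rdsum A B) (rdsum C D) \<longrightarrow> D \<in> Ob)"

text \<open>|I| is a measurable cardinal (Ulam/Los sense): there is a non-principal
  countably complete ultrafilter on I.\<close>
definition measurable_set :: "'i set \<Rightarrow> bool" where
  "measurable_set I \<longleftrightarrow> (\<exists>U. U \<subseteq> Pow I \<and> I \<in> U \<and> {} \<notin> U \<and>
     (\<forall>X\<in>U. \<forall>Y. X \<subseteq> Y \<and> Y \<subseteq> I \<longrightarrow> Y \<in> U) \<and>
     (\<forall>X. X \<subseteq> I \<longrightarrow> X \<in> U \<or> I - X \<in> U) \<and>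
     (\<forall>F. countable F \<and> F \<noteq> {} \<and> F \<subseteq> U \<longrightarrow> \<Inter>F \<in> U) \<and>
     (\<forall>x\<in>I. {x} \<notin> U))"

end

theory Submission
  imports Defs
begin

text \<open>
  A homomorphism from a product with non-measurable index set to a slender module only depends on
  finitely many coordinates. Hence for every finite \<open>F \<subseteq> I\<close> the identity of \<open>\<Prod>i\<in>F. A i\<close> factors
  through some finite product \<open>\<Prod>j\<in>G. B j\<close>, that is, the identity matrix is a product of matrices
  over the category. Gaussian elimination modulo \<open>P\<close> turns this factorization into an injection
  \<open>F \<rightarrow> G\<close> that preserves \<open>P\<close> classes. By symmetry, the members of a given \<open>P\<close> class in the two
  families form countable sets whose finite subsets inject into one another, so these sets are
  equipotent.
\<close>

section \<open>Elimination modulo a completely prime ideal\<close>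

text \<open>An endomorphism outside \<open>P\<close> may still lie in \<open>Q\<close> and fail to
  be invertible, so endomorphism rings need not be local and the usual exchange argument has no
  invertible pivots. Modulo \<open>P\<close> a pivot needs only a left inverse up to an error in
  \<open>P\<close>, and \<open>Q\<close> helps to find one. As each ideal is treated separately, the
  \<open>P\<close> classes and the \<open>Q\<close> classes are matched by two unrelated bijections.
  The isomorphism of the products has no finite matrix: the image of a single \<open>A k\<close> may
  have infinitely many nonzero components in the product of the \<open>B j\<close>. A map from that
  product to a slender \<open>A i\<close> reads only finitely many of them, which is why only finite
  subfamilies can be compared and each comparison gives an injection in one direction. Such
  comparisons determine the size of a finite class, but of an infinite class they reveal only that
  it is infinite; countability closes this gap. Non-measurability enters where a map that kills
  every single coordinate of an element must be shown to kill the element: a counterexample would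
  yield a nonprincipal countably complete ultrafilter on the index set.\<close>

locale preadditive_category =
  fixes Ob :: "'o set"
    and Hom :: "'o \<Rightarrow> 'o \<Rightarrow> 'm ring"
    and cmp :: "'o \<Rightarrow> 'm \<Rightarrow> 'm \<Rightarrow> 'm"
    and ident :: "'o \<Rightarrow> 'm"
  assumes abelian_group_Hom: "\<lbrakk>X \<in> Ob; Y \<in> Ob\<rbrakk> \<Longrightarrow> abelian_group (Hom X Y)"
    and cmp_closed: "\<lbrakk>X \<in> Ob; Y \<in> Ob; Z \<in> Ob; f \<in> carrier (Hom X Y); g \<in> carrier (Hom Y Z)\<rbrakk>
      \<Longrightarrow> cmp X g f \<in> carrier (Hom X Z)"
    and cmp_assoc: "\<lbrakk>X \<in> Ob; Y \<in> Ob; Z \<in> Ob; W \<in> Ob;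
        f \<in> carrier (Hom X Y); g \<in> carrier (Hom Y Z); h \<in> carrier (Hom Z W)\<rbrakk>
      \<Longrightarrow> cmp X (cmp Y h g) f = cmp X h (cmp X g f)"
    and cmp_add_left: "\<lbrakk>X \<in> Ob; Y \<in> Ob; Z \<in> Ob; f \<in> carrier (Hom X Y);
        g \<in> carrier (Hom Y Z); h \<in> carrier (Hom Y Z)\<rbrakk>
      \<Longrightarrow> cmp X (g \<oplus>\<^bsub>Hom Y Z\<^esub> h) f = cmp X g f \<oplus>\<^bsub>Hom X Z\<^esub> cmp X h f"
    and cmp_add_right: "\<lbrakk>X \<in> Ob; Y \<in> Ob; Z \<in> Ob; f \<in> carrier (Hom X Y);
        g \<in> carrier (Hom X Y); h \<in> carrier (Hom Y Z)\<rbrakk>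
      \<Longrightarrow> cmp X h (f \<oplus>\<^bsub>Hom X Y\<^esub> g) = cmp X h f \<oplus>\<^bsub>Hom X Z\<^esub> cmp X h g"
    and ident_closed: "X \<in> Ob \<Longrightarrow> ident X \<in> carrier (Hom X X)"
    and cmp_ident_right: "\<lbrakk>X \<in> Ob; Y \<in> Ob; f \<in> carrier (Hom X Y)\<rbrakk> \<Longrightarrow> cmp X f (ident X) = f"
    and cmp_ident_left: "\<lbrakk>X \<in> Ob; Y \<in> Ob; f \<in> carrier (Hom X Y)\<rbrakk> \<Longrightarrow> cmp X (ident Y) f = f"
begin

lemma minus_Hom_closed:
  assumes "X \<in> Ob" "Y \<in> Ob" "f \<in> carrier (Hom X Y)" "g \<in> carrier (Hom X Y)"
  shows "f \<ominus>\<^bsub>Hom X Y\<^esub> g \<in> carrier (Hom X Y)"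
proof -
  interpret abelian_group "Hom X Y" using assms by (simp add: abelian_group_Hom)
  show ?thesis using assms by simp
qed

lemma cmp_minus_left:
  assumes ob: "X \<in> Ob" "Y \<in> Ob" "Z \<in> Ob" and f: "f \<in> carrier (Hom X Y)"
    and g: "g \<in> carrier (Hom Y Z)" and h: "h \<in> carrier (Hom Y Z)"
  shows "cmp X (g \<ominus>\<^bsub>Hom Y Z\<^esub> h) f = cmp X g f \<ominus>\<^bsub>Hom X Z\<^esub> cmp X h f"
proof -
  interpret YZ: abelian_group "Hom Y Z" using ob by (simp add: abelian_group_Hom)
  interpret XZ: abelian_group "Hom X Z" using ob by (simp add: abelian_group_Hom)
  let ?d = "g \<ominus>\<^bsub>Hom Y Z\<^esub> h"
  have d: "?d \<in> carrier (Hom Y Z)" using g h by simp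
  have "?d \<oplus>\<^bsub>Hom Y Z\<^esub> h = g" using g h by (simp add: YZ.minus_eq YZ.a_assoc YZ.l_neg)
  then have "cmp X ?d f \<oplus>\<^bsub>Hom X Z\<^esub> cmp X h f = cmp X g f"
    using cmp_add_left[OF ob f d h] by simp
  moreover have "cmp X ?d f \<in> carrier (Hom X Z)" "cmp X h f \<in> carrier (Hom X Z)"
    using ob f d h cmp_closed by blast+
  ultimately show ?thesis
    by (metis XZ.a_assoc XZ.a_inv_closed XZ.minus_eq XZ.r_neg XZ.r_zero)
qed

lemma cmp_minus_right:
  assumes ob: "X \<in> Ob" "Y \<in> Ob" "Z \<in> Ob" and f: "f \<in> carrier (Hom X Y)"
    and g: "g \<in> carrier (Hom X Y)" and h: "h \<in> carrier (Hom Y Z)"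
  shows "cmp X h (f \<ominus>\<^bsub>Hom X Y\<^esub> g) = cmp X h f \<ominus>\<^bsub>Hom X Z\<^esub> cmp X h g"
proof -
  interpret XY: abelian_group "Hom X Y" using ob by (simp add: abelian_group_Hom)
  interpret XZ: abelian_group "Hom X Z" using ob by (simp add: abelian_group_Hom)
  let ?d = "f \<ominus>\<^bsub>Hom X Y\<^esub> g"
  have d: "?d \<in> carrier (Hom X Y)" using f g by simp
  have "?d \<oplus>\<^bsub>Hom X Y\<^esub> g = f" using f g by (simp add: XY.minus_eq XY.a_assoc XY.l_neg)
  then have "cmp X h ?d \<oplus>\<^bsub>Hom X Z\<^esub> cmp X h g = cmp X h f"
    using cmp_add_right[OF ob d g h] by simp
  moreover have "cmp X h ?d \<in> carrier (Hom X Z)" "cmp X h g \<in> carrier (Hom X Z)"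
    using ob g d h cmp_closed by blast+
  ultimately show ?thesis
    by (metis XZ.a_assoc XZ.a_inv_closed XZ.minus_eq XZ.r_neg XZ.r_zero)
qed

text \<open>The effect of a column operation on a matrix product: \<open>n\<close> and
  \<open>n'\<close> are two columns, \<open>m\<close> is a row, and \<open>w\<close> is the
  multiplier acting on the right. It computes the product after one elimination step.\<close>

lemma finsum_cmp_minus:
  assumes fin: "finite G" and ob: "X \<in> Ob" "Y \<in> Ob" "Z \<in> Ob" "B \<in> G \<rightarrow> Ob"
    and m: "\<And>l. l \<in> G \<Longrightarrow> m l \<in> carrier (Hom (B l) Z)"
    and n: "\<And>l. l \<in> G \<Longrightarrow> n l \<in> carrier (Hom X (B l))"
    and n': "\<And>l. l \<in> G \<Longrightarrow> n' l \<in> carrier (Hom Y (B l))"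
    and w: "w \<in> carrier (Hom X Y)"
  shows "(\<Oplus>\<^bsub>Hom X Z\<^esub>l\<in>G. cmp X (m l) (n l \<ominus>\<^bsub>Hom X (B l)\<^esub> cmp X (n' l) w)) =
    (\<Oplus>\<^bsub>Hom X Z\<^esub>l\<in>G. cmp X (m l) (n l)) \<ominus>\<^bsub>Hom X Z\<^esub>
      cmp X (\<Oplus>\<^bsub>Hom Y Z\<^esub>l\<in>G. cmp Y (m l) (n' l)) w"
  using fin ob(4) m n n'
proof (induction G)
  case empty
  interpret XZ: abelian_group "Hom X Z" using ob by (simp add: abelian_group_Hom)
  interpret YZ: abelian_group "Hom Y Z" using ob by (simp add: abelian_group_Hom)
  \<comment> \<open>The axioms do not mention composition with zero; that it gives zero follows from
    additivity by writing zero as a difference of zeros.\<close>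
  have "cmp X (\<zero>\<^bsub>Hom Y Z\<^esub> \<ominus>\<^bsub>Hom Y Z\<^esub> \<zero>\<^bsub>Hom Y Z\<^esub>) w = \<zero>\<^bsub>Hom X Z\<^esub>"
    using ob w cmp_closed[OF ob(1-3) w YZ.zero_closed]
    by (subst cmp_minus_left[where Y = Y]) (auto simp: XZ.minus_eq XZ.r_neg)
  moreover have "\<zero>\<^bsub>Hom Y Z\<^esub> \<ominus>\<^bsub>Hom Y Z\<^esub> \<zero>\<^bsub>Hom Y Z\<^esub> = \<zero>\<^bsub>Hom Y Z\<^esub>"
    by (simp only: YZ.minus_eq YZ.r_neg YZ.zero_closed)
  moreover have "\<zero>\<^bsub>Hom X Z\<^esub> \<ominus>\<^bsub>Hom X Z\<^esub> \<zero>\<^bsub>Hom X Z\<^esub> = \<zero>\<^bsub>Hom X Z\<^esub>"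
    by (simp only: XZ.minus_eq XZ.r_neg XZ.zero_closed)
  ultimately show ?case by simp
next
  case (insert l G)
  interpret XZ: abelian_group "Hom X Z" using ob by (simp add: abelian_group_Hom)
  interpret YZ: abelian_group "Hom Y Z" using ob by (simp add: abelian_group_Hom)
  let ?S = "\<Oplus>\<^bsub>Hom X Z\<^esub>l\<in>G. cmp X (m l) (n l)" and ?T = "\<Oplus>\<^bsub>Hom Y Z\<^esub>l\<in>G. cmp Y (m l) (n' l)"
  have Bl: "\<And>i. i \<in> insert l G \<Longrightarrow> B i \<in> Ob" using insert.prems by blast
  have c1: "cmp X (m i) (n i) \<in> carrier (Hom X Z)" if "i \<in> insert l G" for i
    by (rule cmp_closed[OF ob(1) Bl ob(3)]) (use that insert.prems in auto)
  have c2: "cmp Y (m i) (n' i) \<in> carrier (Hom Y Z)" if "i \<in> insert l G" for i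
    by (rule cmp_closed[OF ob(2) Bl ob(3)]) (use that insert.prems in auto)
  have c3: "cmp X (n' i) w \<in> carrier (Hom X (B i))" if "i \<in> insert l G" for i
    by (rule cmp_closed[OF ob(1,2) Bl w]) (use that insert.prems in auto)
  have c4: "n i \<ominus>\<^bsub>Hom X (B i)\<^esub> cmp X (n' i) w \<in> carrier (Hom X (B i))" if "i \<in> insert l G" for i
    by (rule minus_Hom_closed[OF ob(1) Bl _ c3]) (use that insert.prems in auto)
  have c5: "cmp X (m i) (n i \<ominus>\<^bsub>Hom X (B i)\<^esub> cmp X (n' i) w) \<in> carrier (Hom X Z)"
    if "i \<in> insert l G" for i
    by (rule cmp_closed[OF ob(1) Bl ob(3) c4]) (use that insert.prems in auto)
  have S: "?S \<in> carrier (Hom X Z)" and T: "?T \<in> carrier (Hom Y Z)"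
    using c1 c2 by auto
  have Tw: "cmp X ?T w \<in> carrier (Hom X Z)" using cmp_closed[OF ob(1-3) w T] .
  have u: "cmp X (cmp Y (m l) (n' l)) w \<in> carrier (Hom X Z)"
    using cmp_closed[OF ob(1-3) w c2[of l]] by simp
  have "cmp X (m l) (n l \<ominus>\<^bsub>Hom X (B l)\<^esub> cmp X (n' l) w) =
      cmp X (m l) (n l) \<ominus>\<^bsub>Hom X Z\<^esub> cmp X (cmp Y (m l) (n' l)) w"
    using cmp_minus_right[OF ob(1) Bl ob(3) _ c3, of l "n l" "m l"]
      cmp_assoc[OF ob(1,2) Bl ob(3) w, of l "n' l" "m l"] insert.prems by simp
  moreover have "cmp X (cmp Y (m l) (n' l) \<oplus>\<^bsub>Hom Y Z\<^esub> ?T) w =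
      cmp X (cmp Y (m l) (n' l)) w \<oplus>\<^bsub>Hom X Z\<^esub> cmp X ?T w"
    using cmp_add_left[OF ob(1-3) w c2 T] by simp
  moreover have "(\<Oplus>\<^bsub>Hom X Z\<^esub>l\<in>G. cmp X (m l) (n l \<ominus>\<^bsub>Hom X (B l)\<^esub> cmp X (n' l) w)) =
      ?S \<ominus>\<^bsub>Hom X Z\<^esub> cmp X ?T w"
    using insert by auto
  ultimately show ?case
    using insert.hyps c1 c2 c5 S Tw u
    by (simp add: XZ.minus_eq XZ.minus_add XZ.a_ac Pi_iff)
qed

end

section \<open>Completely prime ideals and congruence modulo such an ideal\<close>

locale completely_prime_ideal = preadditive_category +
  fixes P :: "'a \<Rightarrow> 'a \<Rightarrow> 'b set"
  assumes ideal_subset: "\<lbrakk>X \<in> Ob; Y \<in> Ob\<rbrakk> \<Longrightarrow> P X Y \<subseteq> carrier (Hom X Y)"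
    and zero_mem: "\<lbrakk>X \<in> Ob; Y \<in> Ob\<rbrakk> \<Longrightarrow> \<zero>\<^bsub>Hom X Y\<^esub> \<in> P X Y"
    and add_mem: "\<lbrakk>X \<in> Ob; Y \<in> Ob; f \<in> P X Y; g \<in> P X Y\<rbrakk> \<Longrightarrow> f \<oplus>\<^bsub>Hom X Y\<^esub> g \<in> P X Y"
    and neg_mem: "\<lbrakk>X \<in> Ob; Y \<in> Ob; f \<in> P X Y\<rbrakk> \<Longrightarrow> \<ominus>\<^bsub>Hom X Y\<^esub> f \<in> P X Y"
    and cmp_mem_iff: "\<lbrakk>X \<in> Ob; Y \<in> Ob; Z \<in> Ob; f \<in> carrier (Hom X Y); g \<in> carrier (Hom Y Z)\<rbrakk>
      \<Longrightarrow> cmp X g f \<in> P X Z \<longleftrightarrow> f \<in> P X Y \<or> g \<in> P Y Z"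
    and ideal_proper: "X \<in> Ob \<Longrightarrow> P X X \<noteq> carrier (Hom X X)"
begin

lemma minus_mem:
  assumes "X \<in> Ob" "Y \<in> Ob" "f \<in> P X Y" "g \<in> P X Y"
  shows "f \<ominus>\<^bsub>Hom X Y\<^esub> g \<in> P X Y"
proof -
  interpret abelian_group "Hom X Y" using assms by (simp add: abelian_group_Hom)
  show ?thesis using assms by (simp add: minus_eq add_mem neg_mem)
qed

text \<open>Since \<open>g\<close> equals \<open>f\<close> minus the difference of \<open>f\<close>
  and \<open>g\<close>. With \<open>g\<close> the identity, which is never in the ideal, this shows
  that a morphism congruent to the identity lies outside the ideal.\<close>

lemma right_mem_of_minus_mem:
  assumes ob: "X \<in> Ob" "Y \<in> Ob" and f: "f \<in> P X Y" and g: "g \<in> carrier (Hom X Y)"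
    and fg: "f \<ominus>\<^bsub>Hom X Y\<^esub> g \<in> P X Y"
  shows "g \<in> P X Y"
proof -
  interpret abelian_group "Hom X Y" using ob by (simp add: abelian_group_Hom)
  have "f \<in> carrier (Hom X Y)" using f ideal_subset ob by blast
  then have "f \<ominus>\<^bsub>Hom X Y\<^esub> (f \<ominus>\<^bsub>Hom X Y\<^esub> g) = g"
    using g by (simp add: minus_eq minus_add a_assoc[symmetric] r_neg)
  then show ?thesis using minus_mem[OF ob f fg] by simp
qed

lemma finsum_mem:
  assumes ob: "X \<in> Ob" "Y \<in> Ob" and "finite G" "\<And>l. l \<in> G \<Longrightarrow> t l \<in> P X Y"
  shows "(\<Oplus>\<^bsub>Hom X Y\<^esub>l\<in>G. t l) \<in> P X Y"
proof -
  interpret abelian_group "Hom X Y" using ob by (simp add: abelian_group_Hom)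
  show ?thesis using assms(3,4)
  proof (induction G)
    case (insert l G)
    have "t \<in> G \<rightarrow> carrier (Hom X Y)" "t l \<in> carrier (Hom X Y)"
      using insert.prems ideal_subset[OF ob] by blast+
    then show ?case using insert add_mem[OF ob] by simp
  qed (simp add: zero_mem ob)
qed

text \<open>Otherwise every endomorphism, being its own composite with the identity, would belong to
  the ideal, against properness.\<close>

lemma ident_not_mem:
  assumes "X \<in> Ob"
  shows "ident X \<notin> P X X"
proof
  assume "ident X \<in> P X X"
  then have "carrier (Hom X X) \<subseteq> P X X"
    by (metis assms cmp_ident_right cmp_mem_iff ident_closed subsetI)
  then show False using ideal_proper ideal_subset assms by blast
qed

end

text \<open>A one-sided inverse is enough here: the congruence on the other side is recovered later
  from primality. The condition is symmetric in \<open>P\<close> and \<open>Q\<close>.\<close>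

locale completely_prime_pair =
  P: completely_prime_ideal Ob Hom cmp ident P + Q: completely_prime_ideal Ob Hom cmp ident Q
  for Ob :: "'o set" and Hom :: "'o \<Rightarrow> 'o \<Rightarrow> 'm ring" and cmp ident P Q +
  assumes left_inverse: "\<lbrakk>X \<in> Ob; e \<in> carrier (Hom X X); e \<notin> P X X; e \<notin> Q X X\<rbrakk>
    \<Longrightarrow> \<exists>u\<in>carrier (Hom X X). cmp X u e = ident X"
begin

text \<open>If some \<open>p\<close> lies in \<open>P X X\<close> but not in \<open>Q X X\<close>, adding it to an endomorphism outside \<open>P X X\<close>
  moves that endomorphism out of \<open>Q X X\<close> without changing it modulo \<open>P\<close>. Otherwise
  \<open>P X X \<subseteq> Q X X\<close>, and a summand outside \<open>Q X X\<close> is already invertible.\<close>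

lemma summand_left_invertible_mod:
  assumes X: "X \<in> Ob" and fin: "finite G"
    and t: "\<And>j. j \<in> G \<Longrightarrow> t j \<in> carrier (Hom X X)"
    and sum: "(\<Oplus>\<^bsub>Hom X X\<^esub>j\<in>G. t j) \<ominus>\<^bsub>Hom X X\<^esub> ident X \<in> P X X"
  shows "\<exists>j\<in>G. \<exists>u\<in>carrier (Hom X X). cmp X u (t j) \<ominus>\<^bsub>Hom X X\<^esub> ident X \<in> P X X"
proof -
  interpret abelian_group "Hom X X" using X by (simp add: P.abelian_group_Hom)
  have id: "ident X \<in> carrier (Hom X X)" using X by (rule P.ident_closed)
  show ?thesis
  proof (cases "P X X \<subseteq> Q X X")
    case True
    \<comment> \<open>In this case the congruence to the identity modulo \<open>P\<close> also holds
      modulo \<open>Q\<close>; if all summands were in \<open>Q\<close>, so would be the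
      identity.\<close>
    have "\<exists>j\<in>G. t j \<notin> Q X X"
      using Q.finsum_mem[OF X X fin, of t] Q.right_mem_of_minus_mem[OF X X _ id] Q.ident_not_mem[OF X]
        sum True by blast
    then obtain j where j: "j \<in> G" "t j \<notin> Q X X" by blast
    then obtain u where u: "u \<in> carrier (Hom X X)" "cmp X u (t j) = ident X"
      using left_inverse[OF X t] True by blast
    then have "cmp X u (t j) \<ominus>\<^bsub>Hom X X\<^esub> ident X \<in> P X X"
      using id X by (simp add: minus_eq r_neg P.zero_mem)
    then show ?thesis using j u by blast
  next
    case False
    then obtain p where p: "p \<in> P X X" "p \<notin> Q X X" by blast
    have pc: "p \<in> carrier (Hom X X)" using p P.ideal_subset X by blast
    have "\<exists>j\<in>G. t j \<notin> P X X"
      using P.finsum_mem[OF X X fin, of t] P.right_mem_of_minus_mem[OF X X _ id] P.ident_not_mem[OF X]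
        sum by blast
    then obtain j where j: "j \<in> G" "t j \<notin> P X X" by blast
    have tj: "t j \<in> carrier (Hom X X)" using t j by blast
    have "\<exists>q\<in>P X X. t j \<oplus>\<^bsub>Hom X X\<^esub> q \<notin> Q X X"
    proof (cases "t j \<in> Q X X")
      case True
      have "(t j \<oplus>\<^bsub>Hom X X\<^esub> p) \<ominus>\<^bsub>Hom X X\<^esub> t j = p"
        using tj pc by (simp add: minus_eq a_ac r_neg)
      then have "t j \<oplus>\<^bsub>Hom X X\<^esub> p \<notin> Q X X"
        using Q.minus_mem[OF X X _ True, of "t j \<oplus>\<^bsub>Hom X X\<^esub> p"] p by auto
      then show ?thesis using p by blast
    next
      case False
      then show ?thesis using tj P.zero_mem[OF X X] by (intro bexI[of _ "\<zero>\<^bsub>Hom X X\<^esub>"]) auto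
    qed
    then obtain q where q: "q \<in> P X X" "t j \<oplus>\<^bsub>Hom X X\<^esub> q \<notin> Q X X" by blast
    have qc: "q \<in> carrier (Hom X X)" using q P.ideal_subset X by blast
    have "(t j \<oplus>\<^bsub>Hom X X\<^esub> q) \<ominus>\<^bsub>Hom X X\<^esub> q = t j"
      using tj qc by (simp add: minus_eq a_assoc r_neg)
    then have "t j \<oplus>\<^bsub>Hom X X\<^esub> q \<notin> P X X"
      using P.minus_mem[OF X X _ q(1), of "t j \<oplus>\<^bsub>Hom X X\<^esub> q"] j by auto
    then obtain u where u: "u \<in> carrier (Hom X X)" "cmp X u (t j \<oplus>\<^bsub>Hom X X\<^esub> q) = ident X"
      using left_inverse[OF X] q tj qc by blast
    have uq: "cmp X u q \<in> P X X" using P.cmp_mem_iff[OF X X X qc u(1)] q by blast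
    then have uqc: "cmp X u q \<in> carrier (Hom X X)" using P.ideal_subset X by blast
    have utc: "cmp X u (t j) \<in> carrier (Hom X X)" using P.cmp_closed[OF X X X tj u(1)] .
    \<comment> \<open>The inverse \<open>u\<close> belongs to the perturbed summand. For
      \<open>t j\<close> itself the error is the negative of \<open>u\<close> after
      \<open>q\<close>, which stays in the ideal because \<open>q\<close> does.\<close>
    have "ident X = cmp X u (t j) \<oplus>\<^bsub>Hom X X\<^esub> cmp X u q"
      using u(2) P.cmp_add_right[OF X X X tj qc u(1)] by simp
    then have "cmp X u (t j) \<ominus>\<^bsub>Hom X X\<^esub> ident X = \<ominus>\<^bsub>Hom X X\<^esub> cmp X u q"
      using uqc utc by (simp add: minus_eq minus_add a_assoc[symmetric] r_neg)
    then show ?thesis using P.neg_mem[OF X X uq] j(1) u(1) by (metis (no_types))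
  qed
qed

abbreviation equiv_mod :: "'o \<Rightarrow> 'o \<Rightarrow> bool" where
  "equiv_mod X Y \<equiv> P X Y \<noteq> carrier (Hom X Y) \<and> P Y X \<noteq> carrier (Hom Y X)"

text \<open>Gaussian elimination modulo \<open>P\<close>: an entry \<open>n\<close> with \<open>h n \<equiv> 1\<close> also satisfies \<open>n h \<equiv> 1\<close>,
  because \<open>(n h - 1) n \<in> P\<close> and \<open>n \<notin> P\<close>; subtracting \<open>N l i \<circ> h \<circ> N j k\<close> from \<open>N l k\<close> then
  clears the pivot row.\<close>

lemma injection_of_matrix_retract_mod:
  assumes "finite F" "finite G" "A \<in> F \<rightarrow> Ob" "B \<in> G \<rightarrow> Ob"
    and "\<And>i j. \<lbrakk>i \<in> F; j \<in> G\<rbrakk> \<Longrightarrow> M i j \<in> carrier (Hom (B j) (A i))"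
    and "\<And>i j. \<lbrakk>i \<in> F; j \<in> G\<rbrakk> \<Longrightarrow> N j i \<in> carrier (Hom (A i) (B j))"
    and "\<And>i. i \<in> F \<Longrightarrow> (\<Oplus>\<^bsub>Hom (A i) (A i)\<^esub>j\<in>G. cmp (A i) (M i j) (N j i))
      \<ominus>\<^bsub>Hom (A i) (A i)\<^esub> ident (A i) \<in> P (A i) (A i)"
    and "\<And>i k. \<lbrakk>i \<in> F; k \<in> F; i \<noteq> k\<rbrakk> \<Longrightarrow>
      (\<Oplus>\<^bsub>Hom (A k) (A i)\<^esub>j\<in>G. cmp (A k) (M i j) (N j k)) \<in> P (A k) (A i)"
  shows "\<exists>s. inj_on s F \<and> s ` F \<subseteq> G \<and> (\<forall>i\<in>F. equiv_mod (A i) (B (s i)))"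
  using assms
\<comment> \<open>\<open>M\<close> can stay fixed: elimination changes columns of \<open>N\<close>
  only and then discards the pivot index from \<open>G\<close>.\<close>
proof (induction F arbitrary: G N rule: finite_induct)
  case empty
  then show ?case by auto
next
  case (insert a F)
  note finG = insert.prems(1) and diag = insert.prems(6) and off = insert.prems(7)
  have A: "A i \<in> Ob" if "i \<in> insert a F" for i using insert.prems(2) that by blast
  have B: "B j \<in> Ob" if "j \<in> G" for j using insert.prems(3) that by blast
  have M: "M i j \<in> carrier (Hom (B j) (A i))" if "i \<in> insert a F" "j \<in> G" for i j
    using insert.prems(4) that .
  have N: "N j i \<in> carrier (Hom (A i) (B j))" if "i \<in> insert a F" "j \<in> G" for i j
    using insert.prems(5) that .
  have a: "a \<in> insert a F" and Aa: "A a \<in> Ob" using A by auto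
  have MN: "cmp (A k) (M i j) (N j k) \<in> carrier (Hom (A k) (A i))"
    if "i \<in> insert a F" "k \<in> insert a F" "j \<in> G" for i j k
    using that by (intro P.cmp_closed[of _ "B j"] A B M N)
  obtain j u where j: "j \<in> G" and u: "u \<in> carrier (Hom (A a) (A a))"
    and "cmp (A a) u (cmp (A a) (M a j) (N j a)) \<ominus>\<^bsub>Hom (A a) (A a)\<^esub> ident (A a) \<in> P (A a) (A a)"
    using summand_left_invertible_mod[OF Aa finG, of "\<lambda>j. cmp (A a) (M a j) (N j a)"]
      MN[OF a a] diag[OF a] by blast
  have Bj: "B j \<in> Ob" using B j .
  define n where "n = N j a"
  \<comment> \<open>\<open>u\<close> is the left inverse modulo \<open>P\<close> of the whole
    product \<open>M a j\<close> after \<open>N j a\<close>; absorbing it into \<open>M a j\<close>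
    gives the left inverse \<open>h\<close> of the pivot \<open>n\<close>.\<close>
  define h where "h = cmp (B j) u (M a j)"
  have n: "n \<in> carrier (Hom (A a) (B j))" using N[OF a j] n_def by simp
  have h: "h \<in> carrier (Hom (B j) (A a))"
    unfolding h_def using P.cmp_closed[OF Bj Aa Aa M[OF a j] u] .
  have idA: "ident (A a) \<in> carrier (Hom (A a) (A a))"
    and idB: "ident (B j) \<in> carrier (Hom (B j) (B j))"
    using P.ident_closed Aa Bj by auto
  have hn: "cmp (A a) h n \<ominus>\<^bsub>Hom (A a) (A a)\<^esub> ident (A a) \<in> P (A a) (A a)"
    using P.cmp_assoc[OF Aa Bj Aa Aa n M[OF a j] u] n_def h_def
    \<open>cmp (A a) u (cmp (A a) (M a j) (N j a)) \<ominus>\<^bsub>Hom (A a) (A a)\<^esub> ident (A a) \<in> P (A a) (A a)\<close>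
    by simp
  have hnc: "cmp (A a) h n \<in> carrier (Hom (A a) (A a))" using P.cmp_closed[OF Aa Bj Aa n h] .
  have nhc: "cmp (B j) n h \<in> carrier (Hom (B j) (B j))" using P.cmp_closed[OF Bj Aa Bj h n] .
  have "cmp (A a) h n \<notin> P (A a) (A a)"
    using P.right_mem_of_minus_mem[OF Aa Aa _ idA hn] P.ident_not_mem[OF Aa] by blast
  then have nP: "n \<notin> P (A a) (B j)" and hP: "h \<notin> P (B j) (A a)"
    using P.cmp_mem_iff[OF Aa Bj Aa n h] by auto
  have nh: "cmp (B j) n h \<ominus>\<^bsub>Hom (B j) (B j)\<^esub> ident (B j) \<in> P (B j) (B j)"
  proof -
    have "cmp (A a) (cmp (B j) n h \<ominus>\<^bsub>Hom (B j) (B j)\<^esub> ident (B j)) n =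
        cmp (A a) n (cmp (A a) h n) \<ominus>\<^bsub>Hom (A a) (B j)\<^esub> n"
      using P.cmp_minus_left[OF Aa Bj Bj n nhc idB] P.cmp_assoc[OF Aa Bj Aa Bj n h n]
        P.cmp_ident_left[OF Aa Bj n] by simp
    also have "\<dots> = cmp (A a) n (cmp (A a) h n \<ominus>\<^bsub>Hom (A a) (A a)\<^esub> ident (A a))"
      using P.cmp_minus_right[OF Aa Aa Bj hnc idA n] P.cmp_ident_right[OF Aa Bj n] by simp
    also have "\<dots> \<in> P (A a) (B j)"
      using P.cmp_mem_iff[OF Aa Aa Bj P.minus_Hom_closed[OF Aa Aa hnc idA] n] hn by blast
    finally show ?thesis
      using P.cmp_mem_iff[OF Aa Bj Bj n P.minus_Hom_closed[OF Bj Bj nhc idB]] nP by blast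
  qed
  define w where "w k = cmp (A k) h (N j k)" for k
  have w: "w k \<in> carrier (Hom (A k) (A a))" if "k \<in> insert a F" for k
    unfolding w_def by (rule P.cmp_closed[OF A Bj Aa N h]) (use that j in auto)
  define N' where "N' l k = N l k \<ominus>\<^bsub>Hom (A k) (B l)\<^esub> cmp (A k) (N l a) (w k)" for l k
  have N': "N' l k \<in> carrier (Hom (A k) (B l))" if "k \<in> insert a F" "l \<in> G" for k l
    unfolding N'_def
    by (rule P.minus_Hom_closed[OF A B N P.cmp_closed[OF A Aa B w N]]) (use that in auto)
  have fin': "finite (G - {j})" using finG by simp
  \<comment> \<open>Summed over all of \<open>G\<close>, the new product differs from the old one by
    the \<open>(i, a)\<close> entry of the old product composed with \<open>w k\<close>; this is
    \<open>?b\<close>, in the ideal because \<open>i \<noteq> a\<close>. Dropping the index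
    \<open>j\<close> costs the term \<open>M i j\<close> after \<open>N' j k\<close>, whose negative
    is \<open>?c\<close>; it is in the ideal because the pivot row has been cleared modulo
    \<open>P\<close>.\<close>
  have reduced: "\<exists>p\<in>P (A k) (A i). (\<Oplus>\<^bsub>Hom (A k) (A i)\<^esub>l\<in>G - {j}. cmp (A k) (M i l) (N' l k)) =
      (\<Oplus>\<^bsub>Hom (A k) (A i)\<^esub>l\<in>G. cmp (A k) (M i l) (N l k)) \<oplus>\<^bsub>Hom (A k) (A i)\<^esub> p"
    if ik: "i \<in> F" "k \<in> F" for i k
  proof -
    have i: "i \<in> insert a F" "A i \<in> Ob" and k: "k \<in> insert a F" "A k \<in> Ob" and ia: "i \<noteq> a"
      using ik A insert.hyps by auto
    interpret ki: abelian_group "Hom (A k) (A i)" using i k by (simp add: P.abelian_group_Hom)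
    interpret ai: abelian_group "Hom (A a) (A i)" using i Aa by (simp add: P.abelian_group_Hom)
    let ?S = "\<lambda>G k. \<Oplus>\<^bsub>Hom (A k) (A i)\<^esub>l\<in>G. cmp (A k) (M i l) (N l k)"
    have wk: "w k \<in> carrier (Hom (A k) (A a))" using w k by blast
    have Mij: "M i j \<in> carrier (Hom (B j) (A i))" and Njk: "N j k \<in> carrier (Hom (A k) (B j))"
      using M N i k j by auto
    have Sk: "?S G k = cmp (A k) (M i j) (N j k) \<oplus>\<^bsub>Hom (A k) (A i)\<^esub> ?S (G - {j}) k"
      using ki.finsum_insert[of "G - {j}" j "\<lambda>l. cmp (A k) (M i l) (N l k)"] fin' j MN i k
      by (auto simp: insert_absorb Pi_iff)
    have Sa: "?S G a = cmp (A a) (M i j) n \<oplus>\<^bsub>Hom (A a) (A i)\<^esub> ?S (G - {j}) a"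
      using ai.finsum_insert[of "G - {j}" j "\<lambda>l. cmp (A a) (M i l) (N l a)"] fin' j MN i a
      by (auto simp: insert_absorb Pi_iff n_def)
    have Skc: "?S (G - {j}) k \<in> carrier (Hom (A k) (A i))"
      and Sac: "?S (G - {j}) a \<in> carrier (Hom (A a) (A i))"
      using MN i k a by (auto intro!: ki.finsum_closed ai.finsum_closed)
    have ci: "cmp (A k) (M i j) (N j k) \<in> carrier (Hom (A k) (A i))"
      and ca: "cmp (A a) (M i j) n \<in> carrier (Hom (A a) (A i))"
      using MN[OF i(1) k(1) j] MN[OF i(1) a j] n_def by auto
    let ?b = "cmp (A k) (?S G a) (w k)"
    have SaP: "?S G a \<in> P (A a) (A i)" using off[OF i(1) a ia] .
    then have b: "?b \<in> P (A k) (A i)"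
      using P.cmp_mem_iff[OF k(2) Aa i(2) wk] P.ideal_subset[OF Aa i(2)] by blast
    let ?e = "cmp (B j) n h \<ominus>\<^bsub>Hom (B j) (B j)\<^esub> ident (B j)"
    let ?c = "cmp (A k) (M i j) (cmp (A k) ?e (N j k))"
    have ec: "?e \<in> carrier (Hom (B j) (B j))" using P.minus_Hom_closed[OF Bj Bj nhc idB] .
    have eN: "cmp (A k) ?e (N j k) \<in> P (A k) (B j)"
      using P.cmp_mem_iff[OF k(2) Bj Bj Njk ec] nh by blast
    then have c: "?c \<in> P (A k) (A i)"
      using P.cmp_mem_iff[OF k(2) Bj i(2) _ Mij] P.ideal_subset[OF k(2) Bj] by blast
    have nw: "cmp (A k) (cmp (B j) n h) (N j k) = cmp (A k) n (w k)"
      unfolding w_def using P.cmp_assoc[OF k(2) Bj Aa Bj Njk h n] .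
    have nwc: "cmp (A k) n (w k) \<in> carrier (Hom (A k) (B j))"
      using P.cmp_closed[OF k(2) Aa Bj wk n] .
    have ceq: "?c = cmp (A k) (cmp (A a) (M i j) n) (w k) \<ominus>\<^bsub>Hom (A k) (A i)\<^esub> cmp (A k) (M i j) (N j k)"
      using P.cmp_minus_left[OF k(2) Bj Bj Njk nhc idB] nw P.cmp_ident_left[OF k(2) Bj Njk]
        P.cmp_minus_right[OF k(2) Bj i(2) nwc Njk Mij] P.cmp_assoc[OF k(2) Aa Bj i(2) wk n Mij]
      by simp
    have beq: "?b = cmp (A k) (cmp (A a) (M i j) n) (w k)
        \<oplus>\<^bsub>Hom (A k) (A i)\<^esub> cmp (A k) (?S (G - {j}) a) (w k)"
      using Sa P.cmp_add_left[OF k(2) Aa i(2) wk ca Sac] by simp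
    have x: "cmp (A k) (cmp (A a) (M i j) n) (w k) \<in> carrier (Hom (A k) (A i))"
      and y: "cmp (A k) (?S (G - {j}) a) (w k) \<in> carrier (Hom (A k) (A i))"
      using P.cmp_closed[OF k(2) Aa i(2) wk] ca Sac by auto
    have "(\<Oplus>\<^bsub>Hom (A k) (A i)\<^esub>l\<in>G - {j}. cmp (A k) (M i l) (N' l k)) =
        ?S (G - {j}) k \<ominus>\<^bsub>Hom (A k) (A i)\<^esub> cmp (A k) (?S (G - {j}) a) (w k)"
      unfolding N'_def using P.finsum_cmp_minus[OF fin' k(2) Aa i(2) _ _ _ _ wk, of B "M i"
          "\<lambda>l. N l k" "\<lambda>l. N l a"] B M N i k a by auto
    also have "\<dots> = ?S G k \<oplus>\<^bsub>Hom (A k) (A i)\<^esub> (?c \<ominus>\<^bsub>Hom (A k) (A i)\<^esub> ?b)"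
      unfolding Sk ceq beq using x y ci Skc
      by (simp add: ki.minus_eq ki.minus_add ki.a_ac ki.r_neg1 ki.r_neg2 ki.r_neg ki.l_neg)
    finally show ?thesis using P.minus_mem[OF k(2) i(2) c b] by blast
  qed
  have "\<exists>s. inj_on s F \<and> s ` F \<subseteq> G - {j} \<and> (\<forall>i\<in>F. equiv_mod (A i) (B (s i)))"
  proof (rule insert.IH[OF fin', of N'])
    show "A \<in> F \<rightarrow> Ob" "B \<in> G - {j} \<rightarrow> Ob" using A B by auto
    show "M i l \<in> carrier (Hom (B l) (A i))" if "i \<in> F" "l \<in> G - {j}" for i l
      using M that by blast
    show "N' l i \<in> carrier (Hom (A i) (B l))" if "i \<in> F" "l \<in> G - {j}" for i l
      using N' that by blast
    show "(\<Oplus>\<^bsub>Hom (A i) (A i)\<^esub>l\<in>G - {j}. cmp (A i) (M i l) (N' l i))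
        \<ominus>\<^bsub>Hom (A i) (A i)\<^esub> ident (A i) \<in> P (A i) (A i)" if i: "i \<in> F" for i
    proof -
      have Ai: "A i \<in> Ob" using A i by blast
      interpret abelian_group "Hom (A i) (A i)" using Ai by (simp add: P.abelian_group_Hom)
      let ?S = "\<Oplus>\<^bsub>Hom (A i) (A i)\<^esub>l\<in>G. cmp (A i) (M i l) (N l i)"
      obtain p where p: "p \<in> P (A i) (A i)" and eq:
        "(\<Oplus>\<^bsub>Hom (A i) (A i)\<^esub>l\<in>G - {j}. cmp (A i) (M i l) (N' l i)) = ?S \<oplus>\<^bsub>Hom (A i) (A i)\<^esub> p"
        using reduced[OF i i] by blast
      have pc: "p \<in> carrier (Hom (A i) (A i))" using p P.ideal_subset Ai by blast
      have Sc: "?S \<in> carrier (Hom (A i) (A i))" using MN i by (auto intro!: finsum_closed)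
      have "?S \<oplus>\<^bsub>Hom (A i) (A i)\<^esub> p \<ominus>\<^bsub>Hom (A i) (A i)\<^esub> ident (A i) =
          (?S \<ominus>\<^bsub>Hom (A i) (A i)\<^esub> ident (A i)) \<oplus>\<^bsub>Hom (A i) (A i)\<^esub> p"
        using pc Sc P.ident_closed[OF Ai] by (simp add: minus_eq a_ac)
      then show ?thesis using eq P.add_mem[OF Ai Ai diag p] i by auto
    qed
    show "(\<Oplus>\<^bsub>Hom (A k) (A i)\<^esub>l\<in>G - {j}. cmp (A k) (M i l) (N' l k)) \<in> P (A k) (A i)"
      if ik: "i \<in> F" "k \<in> F" "i \<noteq> k" for i k
      using reduced[OF ik(1,2)] off[of i k] P.add_mem[of "A k" "A i"] A ik by auto
  qed
  then obtain s where s: "inj_on s F" "s ` F \<subseteq> G - {j}" "\<forall>i\<in>F. equiv_mod (A i) (B (s i))"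
    by blast
  have "equiv_mod (A a) (B j)" using n nP h hP by blast
  then have "\<forall>i\<in>insert a F. equiv_mod (A i) (B ((s(a := j)) i))" using s(3) by auto
  moreover have "inj_on (s(a := j)) (insert a F)"
    using s(1,2) insert.hyps by (auto simp: inj_on_def)
  moreover have "(s(a := j)) ` insert a F \<subseteq> G" using s(2) j by auto
  ultimately show ?case by blast
qed

end

section \<open>Right modules\<close>

text \<open>A module viewed as a ring record, because \<open>abelian_group\<close> and finite sums
  are stated for such records. The fields \<open>mult\<close> and \<open>one\<close> are
  fillers.\<close>

definition add_group :: "('a, 'r) rmod \<Rightarrow> 'a ring" where
  "add_group M = \<lparr>carrier = carrier M, mult = radd M, one = rzero M, zero = rzero M, add = radd M\<rparr>"

lemma add_group_simps [simp]:
  "carrier (add_group M) = carrier M" "zero (add_group M) = rzero M" "add (add_group M) = radd M"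
  by (simp_all add: add_group_def)

locale rmodule =
  fixes R :: "'r ring" and M :: "('a, 'r) rmod"
  assumes right_module: "right_module R M"

sublocale rmodule \<subseteq> G: abelian_group "add_group M"
  rewrites "carrier (add_group M) = carrier M"
    and "zero (add_group M) = rzero M"
    and "add (add_group M) = radd M"
proof -
  show "abelian_group (add_group M)"
    using right_module by (intro abelian_groupI) (auto simp: right_module_def)
qed simp_all

context rmodule
begin

lemma
  assumes x: "x \<in> carrier M" and r: "r \<in> carrier R"
  shows smult_closed [simp]: "rsmult M x r \<in> carrier M"
    and smult_add_right: "s \<in> carrier R \<Longrightarrow>
      rsmult M x (r \<oplus>\<^bsub>R\<^esub> s) = radd M (rsmult M x r) (rsmult M x s)"
    and smult_add_left: "y \<in> carrier M \<Longrightarrow>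
      rsmult M (radd M x y) r = radd M (rsmult M x r) (rsmult M y r)"
    and smult_mult: "s \<in> carrier R \<Longrightarrow> rsmult M x (r \<otimes>\<^bsub>R\<^esub> s) = rsmult M (rsmult M x r) s"
  using right_module x r by (auto simp: right_module_def)

lemma smult_one [simp]: "x \<in> carrier M \<Longrightarrow> rsmult M x \<one>\<^bsub>R\<^esub> = x"
  using right_module by (auto simp: right_module_def)

lemma ring_R: "ring R"
  using right_module by (simp add: right_module_def)

lemma idem_zero: "\<lbrakk>x \<in> carrier M; radd M x x = x\<rbrakk> \<Longrightarrow> x = rzero M"
  by (metis G.add.r_cancel_one')

lemma smult_zero_right [simp]:
  assumes "x \<in> carrier M" shows "rsmult M x \<zero>\<^bsub>R\<^esub> = rzero M"
proof -
  interpret R: ring R by (rule ring_R)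
  have "radd M (rsmult M x \<zero>\<^bsub>R\<^esub>) (rsmult M x \<zero>\<^bsub>R\<^esub>) = rsmult M x \<zero>\<^bsub>R\<^esub>"
    using smult_add_right[OF assms R.zero_closed R.zero_closed] by simp
  then show ?thesis using assms by (intro idem_zero) auto
qed

lemma smult_zero_left [simp]:
  assumes "r \<in> carrier R" shows "rsmult M (rzero M) r = rzero M"
proof -
  have "radd M (rsmult M (rzero M) r) (rsmult M (rzero M) r) = rsmult M (rzero M) r"
    using smult_add_left[of "rzero M" r "rzero M"] assms by simp
  then show ?thesis using assms by (intro idem_zero) auto
qed

lemma smult_finsum:
  assumes "finite S" "t \<in> S \<rightarrow> carrier M" "r \<in> carrier R"
  shows "rsmult M (\<Oplus>\<^bsub>add_group M\<^esub>n\<in>S. t n) r = (\<Oplus>\<^bsub>add_group M\<^esub>n\<in>S. rsmult M (t n) r)"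
  using assms by (induction S) (auto simp: smult_add_left Pi_iff)

end

lemma right_module_rprod:
  assumes R: "ring R" and A: "\<And>i. i \<in> I \<Longrightarrow> right_module R (A i)"
  shows "right_module R (rprod I A)"
proof -
  note ax = A[unfolded right_module_def]
  have neg: "\<exists>y\<in>Pi\<^sub>E I (\<lambda>i. carrier (A i)).
      (\<lambda>i\<in>I. radd (A i) (x i) (y i)) = (\<lambda>i\<in>I. rzero (A i))"
    if x: "x \<in> Pi\<^sub>E I (\<lambda>i. carrier (A i))" for x
  proof -
    have "\<exists>y\<in>carrier (A i). radd (A i) (x i) y = rzero (A i)" if "i \<in> I" for i
      using ax[OF that] PiE_mem[OF x that] by blast
    then obtain y where "\<forall>i\<in>I. y i \<in> carrier (A i) \<and> radd (A i) (x i) (y i) = rzero (A i)"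
      by metis
    then show ?thesis by (intro bexI[of _ "restrict y I"]) (auto intro!: restrict_ext)
  qed
  \<comment> \<open>Elements of the product are extensional, so a coordinatewise identity on
    \<open>I\<close> becomes an equality of functions.\<close>
  have eta: "(\<lambda>i\<in>I. y i) = x" if "x \<in> Pi\<^sub>E I (\<lambda>i. carrier (A i))" "\<And>i. i \<in> I \<Longrightarrow> y i = x i" for x y
    using PiE_arb[OF that(1)] that(2) by (simp add: fun_eq_iff)
  have mem: "x i \<in> carrier (A i)" if "x \<in> Pi\<^sub>E I (\<lambda>i. carrier (A i))" "i \<in> I" for x i
    using that by (rule PiE_mem)
  have ac: "\<lbrakk>b \<in> carrier (A i); c \<in> carrier (A i)\<rbrakk>
        \<Longrightarrow> radd (A i) a (radd (A i) b c) = radd (A i) b (radd (A i) a c)"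
      "radd (A i) a (rzero (A i)) = a" if "i \<in> I" "a \<in> carrier (A i)" for i a b c
  proof -
    interpret rmodule R "A i" by unfold_locales (rule A[OF that(1)])
    show "\<lbrakk>b \<in> carrier (A i); c \<in> carrier (A i)\<rbrakk>
        \<Longrightarrow> radd (A i) a (radd (A i) b c) = radd (A i) b (radd (A i) a c)"
      "radd (A i) a (rzero (A i)) = a"
      using that by (simp_all add: G.a_lcomm)
  qed
  show ?thesis
    unfolding right_module_def rprod_def partial_object.simps rmod.simps
    by (intro conjI ballI R neg; (intro restrict_ext restrict_PiE_iff[THEN iffD2] ballI eta)?)
      (simp_all add: mem ax ac)
qed

section \<open>Homomorphisms\<close>

lemma
  assumes "f \<in> rhom R M N"
  shows rhom_closed: "x \<in> carrier M \<Longrightarrow> f x \<in> carrier N"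
    and rhom_add: "\<lbrakk>x \<in> carrier M; y \<in> carrier M\<rbrakk> \<Longrightarrow> f (radd M x y) = radd N (f x) (f y)"
    and rhom_smult: "\<lbrakk>x \<in> carrier M; r \<in> carrier R\<rbrakk> \<Longrightarrow> f (rsmult M x r) = rsmult N (f x) r"
    and rhom_extensional: "f \<in> extensional (carrier M)"
  using assms by (auto simp: rhom_def PiE_def)

lemma rhom_eqI:
  assumes "f \<in> rhom R M N" "g \<in> rhom R M N" "\<And>x. x \<in> carrier M \<Longrightarrow> f x = g x"
  shows "f = g"
  using rhom_extensional[OF assms(1)] rhom_extensional[OF assms(2)] assms(3)
  by (rule extensionalityI)

lemma rhom_zero:
  assumes "right_module R M" "right_module R N" "f \<in> rhom R M N"
  shows "f (rzero M) = rzero N"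
proof -
  interpret M: rmodule R M by unfold_locales (rule assms)
  interpret N: rmodule R N by unfold_locales (rule assms)
  show ?thesis
    using rhom_add[OF assms(3), of "rzero M" "rzero M"] rhom_closed[OF assms(3), of "rzero M"]
    by (intro N.idem_zero) auto
qed

lemma restrict_in_rhom:
  assumes "right_module R M"
    and "\<And>x. x \<in> carrier M \<Longrightarrow> f x \<in> carrier N"
    and "\<And>x y. \<lbrakk>x \<in> carrier M; y \<in> carrier M\<rbrakk> \<Longrightarrow> f (radd M x y) = radd N (f x) (f y)"
    and "\<And>x r. \<lbrakk>x \<in> carrier M; r \<in> carrier R\<rbrakk> \<Longrightarrow> f (rsmult M x r) = rsmult N (f x) r"
  shows "restrict f (carrier M) \<in> rhom R M N"
proof -
  interpret rmodule R M by unfold_locales (rule assms)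
  show ?thesis using assms(2-) by (auto simp: rhom_def)
qed

lemma compose_in_rhom:
  assumes "right_module R M" "f \<in> rhom R M N" "g \<in> rhom R N L"
  shows "compose (carrier M) g f \<in> rhom R M L"
  unfolding compose_def using assms
  by (intro restrict_in_rhom) (auto simp: rhom_closed rhom_add rhom_smult)

lemma inv_into_in_rhom:
  assumes M: "right_module R M" and N: "right_module R N" and f: "f \<in> rhom R M N"
    and bij: "bij_betw f (carrier M) (carrier N)"
  shows "restrict (inv_into (carrier M) f) (carrier N) \<in> rhom R N M"
proof -
  interpret M: rmodule R M by unfold_locales (rule M)
  have inj: "inj_on f (carrier M)" and sur: "f ` carrier M = carrier N"
    using bij by (auto simp: bij_betw_def)
  let ?g = "inv_into (carrier M) f"
  have g: "?g y \<in> carrier M" "f (?g y) = y" if "y \<in> carrier N" for y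
    using that sur by (auto simp: inv_into_into f_inv_into_f)
  show ?thesis
  proof (rule restrict_in_rhom[OF N])
    show "?g x \<in> carrier M" if "x \<in> carrier N" for x using g that by blast
    show "?g (radd N x y) = radd M (?g x) (?g y)" if "x \<in> carrier N" "y \<in> carrier N" for x y
      using that g by (intro inv_into_f_eq[OF inj]) (auto simp: rhom_add[OF f])
    show "?g (rsmult N x r) = rsmult M (?g x) r" if "x \<in> carrier N" "r \<in> carrier R" for x r
      using that g by (intro inv_into_f_eq[OF inj]) (auto simp: rhom_smult[OF f])
  qed
qed

text \<open>Again a ring record with fillers for \<open>mult\<close> and \<open>one\<close>:
  composition goes between different Hom groups and cannot be the multiplication of one of
  them.\<close>

definition hom_group :: "'r ring \<Rightarrow> ('a, 'r) rmod \<Rightarrow> ('b, 'r) rmod \<Rightarrow> ('a \<Rightarrow> 'b) ring" where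
  "hom_group R M N = \<lparr>carrier = rhom R M N, mult = hom_add M N, one = hom_zero M N,
     zero = hom_zero M N, add = hom_add M N\<rparr>"

lemma hom_group_simps [simp]:
  "carrier (hom_group R M N) = rhom R M N" "zero (hom_group R M N) = hom_zero M N"
  "add (hom_group R M N) = hom_add M N"
  by (simp_all add: hom_group_def)

lemma abelian_group_hom_group:
  assumes M: "right_module R M" and N: "right_module R N"
  shows "abelian_group (hom_group R M N)"
proof (rule abelian_groupI, unfold hom_group_simps)
  interpret M: rmodule R M by unfold_locales (rule M)
  interpret N: rmodule R N by unfold_locales (rule N)
  show add: "hom_add M N f g \<in> rhom R M N" if "f \<in> rhom R M N" "g \<in> rhom R M N" for f g
    unfolding hom_add_def using that
    by (intro restrict_in_rhom[OF M])
      (auto simp: rhom_closed rhom_add rhom_smult N.smult_add_left N.G.a_ac)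
  show zero: "hom_zero M N \<in> rhom R M N"
    unfolding hom_zero_def by (intro restrict_in_rhom[OF M]) auto
  show "hom_add M N (hom_add M N f g) h = hom_add M N f (hom_add M N g h)"
    if "f \<in> rhom R M N" "g \<in> rhom R M N" "h \<in> rhom R M N" for f g h
    using that by (intro rhom_eqI[of _ R M N] add) (auto simp: hom_add_def rhom_closed N.G.a_assoc)
  show "hom_add M N f g = hom_add M N g f" if "f \<in> rhom R M N" "g \<in> rhom R M N" for f g
    using that by (intro rhom_eqI[of _ R M N] add) (auto simp: hom_add_def rhom_closed N.G.a_comm)
  show "hom_add M N (hom_zero M N) f = f" if "f \<in> rhom R M N" for f
    using that by (intro rhom_eqI[of _ R M N] add zero) (auto simp: hom_add_def hom_zero_def rhom_closed)
  show "\<exists>g\<in>rhom R M N. hom_add M N g f = hom_zero M N" if f: "f \<in> rhom R M N" for f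
  proof
    let ?g = "\<lambda>x\<in>carrier M. \<ominus>\<^bsub>add_group N\<^esub> f x"
    have "\<ominus>\<^bsub>add_group N\<^esub> (rsmult N y r) = rsmult N (\<ominus>\<^bsub>add_group N\<^esub> y) r"
      if "y \<in> carrier N" "r \<in> carrier R" for y r
    proof -
      have "radd N (rsmult N (\<ominus>\<^bsub>add_group N\<^esub> y) r) (rsmult N y r) = rzero N"
        using that N.smult_add_left[of "\<ominus>\<^bsub>add_group N\<^esub> y" r y] by (simp add: N.G.l_neg)
      then show ?thesis using that by (intro N.G.minus_equality) auto
    qed
    then show g: "?g \<in> rhom R M N" using f
      by (intro restrict_in_rhom[OF M])
        (auto simp: rhom_closed rhom_add rhom_smult N.G.minus_add)
    show "hom_add M N ?g f = hom_zero M N"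
      by (rule rhom_eqI[OF add[OF g f] zero])
        (auto simp: hom_add_def hom_zero_def rhom_closed[OF f] N.G.l_neg)
  qed
qed

section \<open>Homomorphisms from products to slender modules\<close>

text \<open>The idempotent of the product that projects onto the coordinates in \<open>S\<close>.
  The set \<open>S\<close> need not lie in \<open>I\<close>, so that complements such as
  \<open>- G\<close> can be used directly.\<close>

definition cutoff :: "'i set \<Rightarrow> ('i \<Rightarrow> ('a, 'r) rmod) \<Rightarrow> 'i set \<Rightarrow> ('i \<Rightarrow> 'a) \<Rightarrow> 'i \<Rightarrow> 'a" where
  "cutoff I A S x = (\<lambda>i\<in>I. if i \<in> S then x i else rzero (A i))"

definition insertion :: "'i set \<Rightarrow> ('i \<Rightarrow> ('a, 'r) rmod) \<Rightarrow> 'i \<Rightarrow> 'a \<Rightarrow> 'i \<Rightarrow> 'a" where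
  "insertion I A i = (\<lambda>a\<in>carrier (A i). \<lambda>k\<in>I. if k = i then a else rzero (A k))"

definition projection :: "'i set \<Rightarrow> ('i \<Rightarrow> ('a, 'r) rmod) \<Rightarrow> 'i \<Rightarrow> ('i \<Rightarrow> 'a) \<Rightarrow> 'a" where
  "projection I A i = (\<lambda>x\<in>carrier (rprod I A). x i)"

lemma rprod_simps [simp]:
  "carrier (rprod I A) = (\<Pi>\<^sub>E i\<in>I. carrier (A i))"
  "radd (rprod I A) x y = (\<lambda>i\<in>I. radd (A i) (x i) (y i))"
  "rzero (rprod I A) = (\<lambda>i\<in>I. rzero (A i))"
  "rsmult (rprod I A) x r = (\<lambda>i\<in>I. rsmult (A i) (x i) r)"
  by (simp_all add: rprod_def)

lemma right_module_ring_rmod: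
  assumes "ring R" shows "right_module R (ring_rmod R)"
proof -
  interpret ring R by (rule assms)
  show ?thesis
    unfolding right_module_def ring_rmod_def
    by (auto simp: a_assoc m_assoc l_distr r_distr ring_axioms intro: a_comm r_neg)
qed

section \<open>Products of a family and their coordinate maps\<close>

locale module_family =
  fixes R :: "'r ring" and I :: "'i set" and A :: "'i \<Rightarrow> ('a, 'r) rmod"
  assumes ring_R: "ring R" and family: "\<And>i. i \<in> I \<Longrightarrow> right_module R (A i)"
begin

abbreviation "prd \<equiv> rprod I A"

lemma right_module_prd: "right_module R prd"
  using ring_R family by (rule right_module_rprod)

sublocale prd: rmodule R prd
  by unfold_locales (rule right_module_prd)

lemma rmodule_family: "i \<in> I \<Longrightarrow> rmodule R (A i)"
  by (rule rmodule.intro) (rule family)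

lemma zero_family_closed [simp]: "i \<in> I \<Longrightarrow> rzero (A i) \<in> carrier (A i)"
  using family by (simp add: right_module_def)

lemma family_zero_add [simp]:
  assumes "i \<in> I" "a \<in> carrier (A i)"
  shows "radd (A i) (rzero (A i)) a = a" "radd (A i) a (rzero (A i)) = a"
proof -
  interpret rmodule R "A i" using assms by (simp add: rmodule_family)
  show "radd (A i) (rzero (A i)) a = a" "radd (A i) a (rzero (A i)) = a" using assms by auto
qed

lemma cutoff_closed: "x \<in> carrier prd \<Longrightarrow> cutoff I A S x \<in> carrier prd"
  by (auto simp: cutoff_def)

lemma cutoff_superset: "\<lbrakk>x \<in> carrier prd; I \<subseteq> S\<rbrakk> \<Longrightarrow> cutoff I A S x = x"
  using PiE_arb[of x I "\<lambda>i. carrier (A i)"] by (auto simp: cutoff_def fun_eq_iff)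

lemma cutoff_empty: "I \<inter> S = {} \<Longrightarrow> cutoff I A S x = rzero prd"
  by (auto simp: cutoff_def fun_eq_iff)

lemma cutoff_cutoff: "cutoff I A S (cutoff I A T x) = cutoff I A (S \<inter> T) x"
  by (auto simp: cutoff_def fun_eq_iff)

lemma cutoff_Un:
  assumes "x \<in> carrier prd" "S \<inter> T = {}"
  shows "cutoff I A (S \<union> T) x = radd prd (cutoff I A S x) (cutoff I A T x)"
  using assms PiE_mem[of x I "\<lambda>i. carrier (A i)"] by (auto simp: cutoff_def fun_eq_iff)

lemma insertion_in_rhom:
  assumes "i \<in> I" shows "insertion I A i \<in> rhom R (A i) prd"
proof -
  have "rsmult (A k) (rzero (A k)) r = rzero (A k)" if "k \<in> I" "r \<in> carrier R" for k r
    using rmodule.smult_zero_left[OF rmodule_family] that .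
  then show ?thesis unfolding insertion_def using assms
    by (intro restrict_in_rhom family) (auto simp: fun_eq_iff)
qed

lemma projection_in_rhom: "i \<in> I \<Longrightarrow> projection I A i \<in> rhom R prd (A i)"
  unfolding projection_def using right_module_prd by (intro restrict_in_rhom) auto

lemma cutoff_singleton:
  "\<lbrakk>x \<in> carrier prd; i \<in> I\<rbrakk> \<Longrightarrow> cutoff I A {i} x = insertion I A i (x i)"
  by (auto simp: cutoff_def insertion_def fun_eq_iff PiE_mem)

end

section \<open>Support of a map from a product to a slender module\<close>

locale slender_target = module_family R I A
  for R :: "'r ring" and I :: "'i set" and A :: "'i \<Rightarrow> ('a, 'r) rmod" +
  fixes M :: "('b, 'r) rmod" and f :: "('i \<Rightarrow> 'a) \<Rightarrow> 'b"
  assumes right_module_M: "right_module R M" and slender_M: "slender R M"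
    and f: "f \<in> rhom R (rprod I A) M"
begin

sublocale M: rmodule R M
  by unfold_locales (rule right_module_M)

lemma f_zero: "f (rzero prd) = rzero M"
  using rhom_zero[OF right_module_prd right_module_M f] .

lemma f_cutoff_Un:
  assumes "x \<in> carrier prd" "S \<inter> T = {}"
  shows "f (cutoff I A (S \<union> T) x) = radd M (f (cutoff I A S x)) (f (cutoff I A T x))"
  using cutoff_Un[OF assms] rhom_add[OF f cutoff_closed cutoff_closed] assms(1) by metis

text \<open>The sequence \<open>xs\<close> induces the homomorphism \<open>r \<mapsto> \<Sum>n. xs n * r n\<close> from \<open>R\<^sup>\<omega>\<close>, the sum being
  finite in every coordinate.\<close>

lemma slender_coordinatewise_finite:
  assumes xs: "\<And>n. xs n \<in> carrier prd"
    and fin: "\<And>i. i \<in> I \<Longrightarrow> finite {n::nat. xs n i \<noteq> rzero (A i)}"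
  shows "\<exists>n0. \<forall>n\<ge>n0. f (xs n) = rzero M"
proof -
  interpret R: ring R by (rule ring_R)
  let ?W = "rprod (UNIV :: nat set) (\<lambda>_. ring_rmod R)"
  let ?N = "\<lambda>i. {n. xs n i \<noteq> rzero (A i)}"
  define \<theta> where
    "\<theta> = (\<lambda>r\<in>carrier ?W. \<lambda>i\<in>I. \<Oplus>\<^bsub>add_group (A i)\<^esub>n\<in>?N i. rsmult (A i) (xs n i) (r n))"
  have W: "right_module R ?W"
    using ring_R right_module_ring_rmod[OF ring_R] by (rule right_module_rprod)
  have xsi: "xs n i \<in> carrier (A i)" if "i \<in> I" for n i using xs that by (auto simp: PiE_mem)
  have r: "r n \<in> carrier R" if "r \<in> carrier ?W" for r n
    using that by (auto simp: ring_rmod_def)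
  have "\<theta> \<in> rhom R ?W prd"
    unfolding \<theta>_def
  proof (rule restrict_in_rhom[OF W])
    show "(\<lambda>i\<in>I. \<Oplus>\<^bsub>add_group (A i)\<^esub>n\<in>?N i. rsmult (A i) (xs n i) (r n)) \<in> carrier prd"
      if "r \<in> carrier ?W" for r
    proof -
      have "(\<Oplus>\<^bsub>add_group (A i)\<^esub>n\<in>?N i. rsmult (A i) (xs n i) (r n)) \<in> carrier (A i)"
        if i: "i \<in> I" for i
      proof -
        interpret rmodule R "A i" using i by (rule rmodule_family)
        show ?thesis using xsi[OF i] r[OF \<open>r \<in> carrier ?W\<close>] by (intro G.finsum_closed) auto
      qed
      then show ?thesis by auto
    qed
    show "(\<lambda>i\<in>I. \<Oplus>\<^bsub>add_group (A i)\<^esub>n\<in>?N i. rsmult (A i) (xs n i) (radd ?W r s n)) =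
        radd prd (\<lambda>i\<in>I. \<Oplus>\<^bsub>add_group (A i)\<^esub>n\<in>?N i. rsmult (A i) (xs n i) (r n))
          (\<lambda>i\<in>I. \<Oplus>\<^bsub>add_group (A i)\<^esub>n\<in>?N i. rsmult (A i) (xs n i) (s n))"
      if rs: "r \<in> carrier ?W" "s \<in> carrier ?W" for r s
    proof -
      have "(\<Oplus>\<^bsub>add_group (A i)\<^esub>n\<in>?N i. rsmult (A i) (xs n i) (r n \<oplus>\<^bsub>R\<^esub> s n)) =
        radd (A i) (\<Oplus>\<^bsub>add_group (A i)\<^esub>n\<in>?N i. rsmult (A i) (xs n i) (r n))
          (\<Oplus>\<^bsub>add_group (A i)\<^esub>n\<in>?N i. rsmult (A i) (xs n i) (s n))"
        if i: "i \<in> I" for i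
      proof -
        interpret rmodule R "A i" using i by (rule rmodule_family)
        show ?thesis using xsi[OF i] r[OF rs(1)] r[OF rs(2)]
          by (subst G.finsum_addf[symmetric]) (auto simp: smult_add_right)
      qed
      then show ?thesis by (auto simp: fun_eq_iff ring_rmod_def)
    qed
    show "(\<lambda>i\<in>I. \<Oplus>\<^bsub>add_group (A i)\<^esub>n\<in>?N i. rsmult (A i) (xs n i) (rsmult ?W r s n)) =
        rsmult prd (\<lambda>i\<in>I. \<Oplus>\<^bsub>add_group (A i)\<^esub>n\<in>?N i. rsmult (A i) (xs n i) (r n)) s"
      if rs: "r \<in> carrier ?W" "s \<in> carrier R" for r s
    proof -
      have "(\<Oplus>\<^bsub>add_group (A i)\<^esub>n\<in>?N i. rsmult (A i) (xs n i) (r n \<otimes>\<^bsub>R\<^esub> s)) =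
        rsmult (A i) (\<Oplus>\<^bsub>add_group (A i)\<^esub>n\<in>?N i. rsmult (A i) (xs n i) (r n)) s"
        if i: "i \<in> I" for i
      proof -
        interpret rmodule R "A i" using i by (rule rmodule_family)
        show ?thesis using xsi[OF i] r[OF rs(1)] rs(2) fin[OF i]
          by (subst smult_finsum) (auto simp: smult_mult)
      qed
      then show ?thesis by (auto simp: fun_eq_iff ring_rmod_def)
    qed
  qed
  then have "compose (carrier ?W) f \<theta> \<in> rhom R ?W M" using W f by (intro compose_in_rhom)
  then obtain n0 where n0: "\<And>n. n \<ge> n0 \<Longrightarrow>
      compose (carrier ?W) f \<theta> (\<lambda>k. if k = n then \<one>\<^bsub>R\<^esub> else \<zero>\<^bsub>R\<^esub>) = rzero M"
    using slender_M unfolding slender_def by blast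
  \<comment> \<open>The unit vectors are sent to the given sequence, so slenderness applied to
    \<open>f\<close> after \<open>\<theta>\<close> is the claim.\<close>
  have "\<theta> (\<lambda>k. if k = n then \<one>\<^bsub>R\<^esub> else \<zero>\<^bsub>R\<^esub>) = xs n" for n
  proof -
    have "(\<Oplus>\<^bsub>add_group (A i)\<^esub>m\<in>?N i. rsmult (A i) (xs m i) (if m = n then \<one>\<^bsub>R\<^esub> else \<zero>\<^bsub>R\<^esub>)) = xs n i"
      if i: "i \<in> I" for i
    proof -
      interpret rmodule R "A i" using i by (rule rmodule_family)
      have "(\<Oplus>\<^bsub>add_group (A i)\<^esub>m\<in>?N i. rsmult (A i) (xs m i) (if m = n then \<one>\<^bsub>R\<^esub> else \<zero>\<^bsub>R\<^esub>)) =
          (\<Oplus>\<^bsub>add_group (A i)\<^esub>m\<in>?N i. if n = m then xs m i else rzero (A i))"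
        using xsi[OF i] by (intro G.finsum_cong') auto
      also have "\<dots> = xs n i"
      proof (cases "n \<in> ?N i")
        case True
        then show ?thesis using G.finsum_singleton[of n "?N i" "\<lambda>m. xs m i"] fin[OF i] xsi[OF i] by auto
      next
        case False
        then have "(\<Oplus>\<^bsub>add_group (A i)\<^esub>m\<in>?N i. if n = m then xs m i else rzero (A i)) =
            (\<Oplus>\<^bsub>add_group (A i)\<^esub>m\<in>?N i. rzero (A i))"
          by (intro G.finsum_cong') auto
        then show ?thesis using False by simp
      qed
      finally show ?thesis .
    qed
    then show ?thesis
      using xs[of n] PiE_arb[of "xs n" I "\<lambda>i. carrier (A i)"]
      by (auto simp: \<theta>_def fun_eq_iff ring_rmod_def)
  qed
  moreover have "(\<lambda>k. if k = n then \<one>\<^bsub>R\<^esub> else \<zero>\<^bsub>R\<^esub>) \<in> carrier ?W" for n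
    by (auto simp: ring_rmod_def)
  ultimately show ?thesis using n0 by (auto simp: compose_def)
qed

text \<open>A coordinate lies in at most one \<open>S n\<close>, so the cutoffs of \<open>x\<close>
  to these sets form a coordinatewise finite sequence. This is the chain condition that produces an
  atom below.\<close>

lemma slender_disjoint:
  assumes x: "x \<in> carrier prd" and disj: "\<And>m n. m < n \<Longrightarrow> S m \<inter> S n = {}"
  shows "\<exists>n::nat. f (cutoff I A (S n) x) = rzero M"
proof -
  have "finite {n. cutoff I A (S n) x i \<noteq> rzero (A i)}" if "i \<in> I" for i
  proof -
    have "{n. cutoff I A (S n) x i \<noteq> rzero (A i)} \<subseteq> {n. i \<in> S n}"
      using that by (auto simp: cutoff_def)
    moreover have "finite {n. i \<in> S n}"
    proof (cases "\<exists>n. i \<in> S n")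
      case True
      then obtain n where n: "i \<in> S n" by blast
      have "{m. i \<in> S m} \<subseteq> {n}"
      proof
        fix m assume "m \<in> {m. i \<in> S m}"
        then show "m \<in> {n}" using n disj[of m n] disj[of n m] by (cases m n rule: linorder_cases) auto
      qed
      then show ?thesis by (rule finite_subset) simp
    qed simp
    ultimately show ?thesis by (rule finite_subset)
  qed
  then show ?thesis using slender_coordinatewise_finite[of "\<lambda>n. cutoff I A (S n) x"] cutoff_closed[OF x] by blast
qed

text \<open>The sets \<open>S\<close> such that \<open>f\<close> kills \<open>x\<close> cut down to any subset of \<open>S\<close> form a countably complete
  ideal (the tails of a countable union have the same image under \<open>f\<close>), and by slenderness there is no
  infinite disjoint family outside it. So if \<open>f x \<noteq> 0\<close> there is an atom, whose associated
  ultrafilter must be principal.\<close>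

lemma nonzero_coordinate:
  assumes nm: "\<not> measurable_set I" and x: "x \<in> carrier prd" and fx: "f x \<noteq> rzero M"
  shows "\<exists>i\<in>I. f (cutoff I A {i} x) \<noteq> rzero M"
proof (rule ccontr)
  assume "\<not> ?thesis"
  then have sing: "f (cutoff I A {i} x) = rzero M" if "i \<in> I" for i using that by blast
  have fcut: "f (cutoff I A S x) \<in> carrier M" for S using rhom_closed[OF f cutoff_closed[OF x]] .
  define Null where "Null S \<longleftrightarrow> (\<forall>T\<subseteq>S. f (cutoff I A T x) = rzero M)" for S
  have null_mono: "Null S" if "Null S'" "S \<subseteq> S'" for S S'
    using that unfolding Null_def by blast
  have null_Union: "Null (\<Union>n::nat. S n)" if S: "\<And>n. Null (S n)" for S
    unfolding Null_def
  proof (intro allI impI)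
    fix T assume T: "T \<subseteq> (\<Union>n. S n)"
    let ?T = "\<lambda>n. T - (\<Union>m<n. S m)"
    have "f (cutoff I A (?T n) x) = f (cutoff I A T x)" for n
    proof (induction n)
      case (Suc n)
      have "?T n = ?T (Suc n) \<union> (?T n \<inter> S n)" by (auto simp: less_Suc_eq)
      moreover have "f (cutoff I A (?T (Suc n) \<union> (?T n \<inter> S n)) x) =
          radd M (f (cutoff I A (?T (Suc n)) x)) (f (cutoff I A (?T n \<inter> S n) x))"
        by (rule f_cutoff_Un[OF x]) auto
      moreover have "f (cutoff I A (?T n \<inter> S n) x) = rzero M"
        using S[of n] unfolding Null_def by blast
      ultimately show ?case using fcut Suc by simp
    qed simp
    \<comment> \<open>An index in \<open>S m\<close> has left \<open>?T n\<close> as soon as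
      \<open>n > m\<close>. It may still be present for \<open>n = m\<close>, since
      \<open>?T m\<close> removes only the sets before \<open>S m\<close>; hence the bound
      \<open>{..m}\<close>.\<close>
    moreover have "finite {n. cutoff I A (?T n) x i \<noteq> rzero (A i)}" if "i \<in> I" for i
    proof (cases "i \<in> T")
      case True
      then obtain m where "i \<in> S m" using T by blast
      then have "{n. cutoff I A (?T n) x i \<noteq> rzero (A i)} \<subseteq> {..m}"
        using that by (auto simp: cutoff_def not_less[symmetric] split: if_splits)
      then show ?thesis by (rule finite_subset) simp
    qed (use that in \<open>simp add: cutoff_def\<close>)
    ultimately show "f (cutoff I A T x) = rzero M"
      using slender_coordinatewise_finite[of "\<lambda>n. cutoff I A (?T n) x"] cutoff_closed[OF x] by auto
  qed
  have null_Un: "Null (S \<union> T)" if "Null S" "Null T" for S T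
  proof -
    let ?U = "\<lambda>n::nat. if n = 0 then S else T"
    have "Null (\<Union>n. ?U n)" by (rule null_Union) (use that in auto)
    moreover have "S \<union> T \<subseteq> (\<Union>n. ?U n)"
      using UN_upper[of 0 UNIV ?U] UN_upper[of 1 UNIV ?U] by simp
    ultimately show ?thesis by (rule null_mono)
  qed
  have "\<exists>S. \<not> Null S \<and> (\<forall>X\<subseteq>S. Null X \<or> Null (S - X))"
  proof (rule ccontr)
    assume "\<not> ?thesis"
    then have "\<forall>S. \<exists>X. \<not> Null S \<longrightarrow> X \<subseteq> S \<and> \<not> Null X \<and> \<not> Null (S - X)" by blast
    then obtain c where c: "\<And>S. \<not> Null S \<Longrightarrow> c S \<subseteq> S \<and> \<not> Null (c S) \<and> \<not> Null (S - c S)" by metis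
    \<comment> \<open>Without an atom, every set that is not null splits into two such sets.
      Starting from \<open>I\<close> and always keeping one half, the discarded halves are pairwise
      disjoint and none is null.\<close>
    define D where "D n = (c ^^ n) I" for n
    have D_Suc: "D (Suc n) = c (D n)" for n by (simp add: D_def)
    have D: "\<not> Null (D n)" for n
    proof (induction n)
      case 0
      then show ?case using fx cutoff_superset[OF x order_refl] unfolding Null_def D_def by force
    qed (simp add: D_Suc c)
    have dec: "D n \<subseteq> D m" if "m \<le> n" for m n
      using that by (induction rule: dec_induct) (use c D D_Suc in auto)
    have "\<exists>T. T \<subseteq> D n - D (Suc n) \<and> f (cutoff I A T x) \<noteq> rzero M" for n
      using c[OF D[of n]] unfolding D_Suc Null_def by blast
    then obtain T where T: "\<And>n. T n \<subseteq> D n - D (Suc n)" "\<And>n. f (cutoff I A (T n) x) \<noteq> rzero M" by metis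
    have "T m \<inter> T n = {}" if "m < n" for m n
      using T(1)[of m] T(1)[of n] dec[of "Suc m" n] that by auto
    then show False using slender_disjoint[OF x, of T] T(2) by blast
  qed
  then obtain S where S: "\<not> Null S" and atom: "\<And>X. X \<subseteq> S \<Longrightarrow> Null X \<or> Null (S - X)" by blast
  have null_empty: "Null {}"
    unfolding Null_def using cutoff_empty f_zero by simp
  have null_outside: "Null X" if "X \<inter> I = {}" for X
    unfolding Null_def using cutoff_empty f_zero that by (metis Int_commute disjoint_iff subsetD)
  have "measurable_set I"
    unfolding measurable_set_def
  \<comment> \<open>A set is large when it contains the atom \<open>S\<close> up to a null set.
    \<open>S\<close> may contain elements outside \<open>I\<close>; \<open>null_outside\<close>
    makes them negligible.\<close>
  proof (intro exI[of _ "{X. X \<subseteq> I \<and> Null (S - X)}"] conjI ballI allI impI)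
    show "I \<in> {X. X \<subseteq> I \<and> Null (S - X)}" using null_outside[of "S - I"] by auto
    show "{} \<notin> {X. X \<subseteq> I \<and> Null (S - X)}" using S by simp
    show "Y \<in> {X. X \<subseteq> I \<and> Null (S - X)}"
      if "X \<in> {X. X \<subseteq> I \<and> Null (S - X)}" "X \<subseteq> Y \<and> Y \<subseteq> I" for X Y
      using that null_mono[of "S - X" "S - Y"] by auto
    show "X \<in> {X. X \<subseteq> I \<and> Null (S - X)} \<or> I - X \<in> {X. X \<subseteq> I \<and> Null (S - X)}"
      if "X \<subseteq> I" for X
    proof -
      have "Null (S - (I - X))" if "Null (S \<inter> X)"
        using null_Un[OF that null_outside[of "S - I"]] by (rule null_mono) auto
      then show ?thesis using atom[of "S \<inter> X"] that by (auto simp: Diff_Int)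
    qed
    show "\<Inter>F \<in> {X. X \<subseteq> I \<and> Null (S - X)}"
      if F: "countable F \<and> F \<noteq> {} \<and> F \<subseteq> {X. X \<subseteq> I \<and> Null (S - X)}" for F
    proof -
      have rng: "range (from_nat_into F) = F" using F by (simp add: range_from_nat_into)
      then have "Null (S - from_nat_into F n)" for n using F by blast
      then have "Null (\<Union>n. S - from_nat_into F n)" by (rule null_Union)
      moreover have "S - \<Inter>F \<subseteq> (\<Union>n. S - from_nat_into F n)" using rng by blast
      ultimately show ?thesis using null_mono F by blast
    qed
    \<comment> \<open>Singletons are null by \<open>sing\<close>, so a large singleton would make
      the atom null.\<close>
    show "{i} \<notin> {X. X \<subseteq> I \<and> Null (S - X)}" if i: "i \<in> I" for i
    proof
      assume "{i} \<in> {X. X \<subseteq> I \<and> Null (S - X)}"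
      moreover have "Null {i}"
        unfolding Null_def using sing[OF i] null_empty by (auto simp: subset_singleton_iff Null_def)
      ultimately have "Null ((S - {i}) \<union> {i})" by (intro null_Un) auto
      then show False using S null_mono[of "(S - {i}) \<union> {i}" S] by blast
    qed
  qed auto
  then show False using nm by blast
qed

text \<open>\<open>G\<close> collects the coordinates on which \<open>f\<close> is not identically
  zero. The witnessing elements vary with the coordinate, so finiteness of \<open>G\<close> needs
  sequences more general than the cutoffs of one fixed element.\<close>

lemma factors_through_finite_subproduct:
  assumes nm: "\<not> measurable_set I"
  shows "\<exists>G. finite G \<and> G \<subseteq> I \<and> (\<forall>x\<in>carrier prd. f x = f (cutoff I A G x))"
proof -
  define G where "G = {i\<in>I. \<exists>x\<in>carrier prd. f (cutoff I A {i} x) \<noteq> rzero M}"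
  have "finite G"
  proof (rule ccontr)
    assume "infinite G"
    then obtain g :: "nat \<Rightarrow> 'i" where g: "inj g" "range g \<subseteq> G"
      using infinite_countable_subset by blast
    have "\<forall>n. \<exists>x. x \<in> carrier prd \<and> f (cutoff I A {g n} x) \<noteq> rzero M"
      using g(2) unfolding G_def by blast
    then obtain xs where xs: "\<And>n. xs n \<in> carrier prd" "\<And>n. f (cutoff I A {g n} (xs n)) \<noteq> rzero M"
      by metis
    have "finite {n. cutoff I A {g n} (xs n) i \<noteq> rzero (A i)}" if "i \<in> I" for i
    proof -
      have "{n. cutoff I A {g n} (xs n) i \<noteq> rzero (A i)} \<subseteq> g -` {i}"
        using that by (auto simp: cutoff_def split: if_splits)
      then show ?thesis by (rule finite_subset) (simp add: finite_vimageI g(1))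
    qed
    then show False
      using slender_coordinatewise_finite[of "\<lambda>n. cutoff I A {g n} (xs n)"] cutoff_closed[OF xs(1)] xs(2)
      by blast
  qed
  moreover have "f x = f (cutoff I A G x)" if x: "x \<in> carrier prd" for x
  proof -
    have fcut: "f (cutoff I A S x) \<in> carrier M" for S using rhom_closed[OF f cutoff_closed[OF x]] .
    \<comment> \<open>A nonzero value would be visible on a single coordinate \<open>i\<close>. That
      coordinate would belong to \<open>G\<close>, yet the element vanishes there.\<close>
    have "f (cutoff I A (- G) x) = rzero M"
    proof (rule ccontr)
      assume "f (cutoff I A (- G) x) \<noteq> rzero M"
      then obtain i where i: "i \<in> I" "f (cutoff I A {i} (cutoff I A (- G) x)) \<noteq> rzero M"
        using nonzero_coordinate[OF nm cutoff_closed[OF x]] by blast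
      have iG: "i \<in> G" unfolding G_def using i cutoff_closed[OF x] by blast
      then have "f (cutoff I A {i} (cutoff I A (- G) x)) = rzero M"
        unfolding cutoff_cutoff using cutoff_empty[of "{i} \<inter> - G"] f_zero by simp
      then show False using i by blast
    qed
    moreover have "f (cutoff I A (G \<union> - G) x) = radd M (f (cutoff I A G x)) (f (cutoff I A (- G) x))"
      by (rule f_cutoff_Un[OF x]) auto
    ultimately show ?thesis using cutoff_superset[OF x, of UNIV] fcut[of G] by simp
  qed
  ultimately show ?thesis unfolding G_def by blast
qed

text \<open>On finitely many coordinates the cutoff is the sum of the maps insertion after
  projection. This turns a composite through the product into an entry of a matrix product: the row
  of \<open>f\<close> times the column of \<open>g\<close>.\<close>

lemma finsum_insertion_projection:
  assumes X: "right_module R X" and g: "g \<in> rhom R X prd" and "finite G" "G \<subseteq> I"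
  shows "(\<Oplus>\<^bsub>hom_group R X M\<^esub>i\<in>G. compose (carrier X) (compose (carrier (A i)) f (insertion I A i))
      (compose (carrier X) (projection I A i) g)) = (\<lambda>a\<in>carrier X. f (cutoff I A G (g a)))"
  using assms(3,4)
proof (induction G)
  case empty
  have "cutoff I A {} x = rzero prd" for x by (rule cutoff_empty) simp
  then show ?case using f_zero by (simp add: hom_zero_def abelian_group_hom_group[OF X right_module_M]
        abelian_monoid.finsum_empty[OF abelian_group.axioms(1)] del: rprod_simps)
next
  case (insert i G)
  interpret H: abelian_group "hom_group R X M" using X right_module_M by (rule abelian_group_hom_group)
  let ?t = "\<lambda>i. compose (carrier X) (compose (carrier (A i)) f (insertion I A i))
      (compose (carrier X) (projection I A i) g)"
  have t: "?t k \<in> carrier (hom_group R X M)" if "k \<in> insert i G" for k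
  proof -
    have k: "k \<in> I" using that insert.prems by blast
    show ?thesis
      using compose_in_rhom[OF X compose_in_rhom[OF X g projection_in_rhom[OF k]]
          compose_in_rhom[OF family[OF k] insertion_in_rhom[OF k] f]] by simp
  qed
  have i: "i \<in> I" using insert.prems by blast
  have "?t i a = f (cutoff I A {i} (g a))" if a: "a \<in> carrier X" for a
  proof -
    have ga: "g a \<in> carrier prd" using rhom_closed[OF g a] .
    then have "g a i \<in> carrier (A i)" using i by (auto simp: PiE_mem)
    then show ?thesis using a ga cutoff_singleton[OF ga i] by (simp add: compose_def projection_def)
  qed
  moreover have "f (cutoff I A ({i} \<union> G) (g a)) =
      radd M (f (cutoff I A {i} (g a))) (f (cutoff I A G (g a)))" if "a \<in> carrier X" for a
    using insert.hyps by (intro f_cutoff_Un rhom_closed[OF g that]) auto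
  ultimately show ?case
    using insert t by (simp add: Pi_iff hom_add_def cong: restrict_cong)
qed

end

section \<open>The category of modules\<close>

lemma (in rmodule) ident_in_rhom: "(\<lambda>x\<in>carrier M. x) \<in> rhom R M M"
  using right_module by (intro restrict_in_rhom) auto

text \<open>Homomorphisms are extensional, so a composite has to be restricted to the carrier of its
  source; for this reason \<open>cmp\<close> takes the source object as an argument.\<close>

lemma preadditive_category_rmod:
  assumes "\<And>M. M \<in> Ob \<Longrightarrow> right_module R M"
  shows "preadditive_category Ob (hom_group R) (\<lambda>M. compose (carrier M)) (\<lambda>M. \<lambda>x\<in>carrier M. x)"
proof -
  note cl = compose_in_rhom[OF assms]
  show ?thesis
  proof (rule preadditive_category.intro, unfold hom_group_simps)
    show "abelian_group (hom_group R X Y)" if "X \<in> Ob" "Y \<in> Ob" for X Y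
      using that by (intro abelian_group_hom_group assms)
    show "compose (carrier X) g f \<in> rhom R X Z"
      if "X \<in> Ob" "f \<in> rhom R X Y" "g \<in> rhom R Y Z" for X Y Z f g
      using that by (rule cl)
    show "compose (carrier X) (compose (carrier Y) h g) f = compose (carrier X) h (compose (carrier X) g f)"
      if "f \<in> rhom R X Y" for X Y f g h
      using rhom_closed[OF that] by (auto simp: compose_def fun_eq_iff)
    show "compose (carrier X) (hom_add Y Z g h) f =
        hom_add X Z (compose (carrier X) g f) (compose (carrier X) h f)"
      if "f \<in> rhom R X Y" for X Y Z f g h
      using rhom_closed[OF that] by (auto simp: compose_def hom_add_def fun_eq_iff)
    show "compose (carrier X) h (hom_add X Y f g) =
        hom_add X Z (compose (carrier X) h f) (compose (carrier X) h g)"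
      if "f \<in> rhom R X Y" "g \<in> rhom R X Y" "h \<in> rhom R Y Z" for X Y Z f g h
      using rhom_closed[OF that(1)] rhom_closed[OF that(2)] rhom_add[OF that(3)]
      by (auto simp: compose_def hom_add_def fun_eq_iff)
    show "(\<lambda>x\<in>carrier X. x) \<in> rhom R X X" if "X \<in> Ob" for X
      using that by (intro rmodule.ident_in_rhom rmodule.intro assms)
    show "compose (carrier X) f (\<lambda>x\<in>carrier X. x) = f" if "f \<in> rhom R X Y" for X Y f
      using extensional_arb[OF rhom_extensional[OF that]] by (auto simp: compose_def fun_eq_iff)
    show "compose (carrier X) (\<lambda>x\<in>carrier Y. x) f = f" if "f \<in> rhom R X Y" for X Y f
      using extensional_arb[OF rhom_extensional[OF that]] rhom_closed[OF that]
      by (auto simp: compose_def fun_eq_iff)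
  qed
qed

lemma completely_prime_ideal_rmod:
  assumes mod: "\<And>M. M \<in> Ob \<Longrightarrow> right_module R M" and P: "completely_prime R Ob P"
  shows "completely_prime_ideal Ob (hom_group R) (\<lambda>M. compose (carrier M)) (\<lambda>M. \<lambda>x\<in>carrier M. x) P"
proof -
  interpret preadditive_category Ob "hom_group R" "\<lambda>M. compose (carrier M)" "\<lambda>M. \<lambda>x\<in>carrier M. x"
    by (rule preadditive_category_rmod[OF mod])
  note P = P[unfolded completely_prime_def]
  show ?thesis
  proof (unfold_locales, unfold hom_group_simps)
    fix X Y assume ob: "X \<in> Ob" "Y \<in> Ob"
    show sub: "P X Y \<subseteq> rhom R X Y" and "hom_zero X Y \<in> P X Y" using P ob by blast+
    show "hom_add X Y f g \<in> P X Y" if "f \<in> P X Y" "g \<in> P X Y" for f g using P ob that by blast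
    show "\<ominus>\<^bsub>hom_group R X Y\<^esub> f \<in> P X Y" if f: "f \<in> P X Y" for f
    proof -
      interpret H: abelian_group "hom_group R X Y" using ob by (rule abelian_group_Hom)
      \<comment> \<open>The definition provides only some additive inverse inside the ideal;
        uniqueness of inverses in the Hom group identifies it with the negative.\<close>
      obtain g where g: "g \<in> P X Y" "hom_add X Y f g = hom_zero X Y" using P ob f by blast
      have "g \<oplus>\<^bsub>hom_group R X Y\<^esub> f = \<zero>\<^bsub>hom_group R X Y\<^esub>"
        using g f sub H.a_comm[of g f] by auto
      then have "\<ominus>\<^bsub>hom_group R X Y\<^esub> f = g" using f g sub by (intro H.minus_equality) auto
      then show ?thesis using g by simp
    qed
  next
    show "compose (carrier X) g f \<in> P X Z \<longleftrightarrow> f \<in> P X Y \<or> g \<in> P Y Z"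
      if "X \<in> Ob" "Y \<in> Ob" "Z \<in> Ob" "f \<in> rhom R X Y" "g \<in> rhom R Y Z" for X Y Z f g
      using P that by blast
    show "P X X \<noteq> rhom R X X" if "X \<in> Ob" for X using P that by blast
  qed
qed

lemma completely_prime_pair_rmod:
  assumes mod: "\<And>M. M \<in> Ob \<Longrightarrow> right_module R M"
    and P: "completely_prime R Ob P" and Q: "completely_prime R Ob Q"
    and aut: "\<And>M f. \<lbrakk>M \<in> Ob; f \<in> rhom R M M; f \<notin> P M M; f \<notin> Q M M\<rbrakk>
      \<Longrightarrow> bij_betw f (carrier M) (carrier M)"
  shows "completely_prime_pair Ob (hom_group R) (\<lambda>M. compose (carrier M)) (\<lambda>M. \<lambda>x\<in>carrier M. x) P Q"
proof -
  interpret P: completely_prime_ideal Ob "hom_group R" "\<lambda>M. compose (carrier M)" "\<lambda>M. \<lambda>x\<in>carrier M. x" P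
    by (rule completely_prime_ideal_rmod[OF mod P])
  interpret Q: completely_prime_ideal Ob "hom_group R" "\<lambda>M. compose (carrier M)" "\<lambda>M. \<lambda>x\<in>carrier M. x" Q
    by (rule completely_prime_ideal_rmod[OF mod Q])
  show ?thesis
  proof (unfold_locales, unfold hom_group_simps)
    fix X e assume X: "X \<in> Ob" and e: "e \<in> rhom R X X" "e \<notin> P X X" "e \<notin> Q X X"
    have bij: "bij_betw e (carrier X) (carrier X)" using aut[OF X e] .
    let ?u = "restrict (inv_into (carrier X) e) (carrier X)"
    have "?u \<in> rhom R X X" using inv_into_in_rhom[OF mod[OF X] mod[OF X] e(1) bij] .
    moreover have "compose (carrier X) ?u e = (\<lambda>x\<in>carrier X. x)"
      using bij rhom_closed[OF e(1)] by (auto simp: compose_def fun_eq_iff bij_betw_def)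
    ultimately show "\<exists>u\<in>rhom R X X. compose (carrier X) u e = (\<lambda>x\<in>carrier X. x)" by blast
  qed
qed

text \<open>The maps \<open>g k\<close> go into the product over \<open>J\<close> and the maps
  \<open>f i\<close> come out of it, with composites forming the identity matrix. Slenderness is
  applied to the \<open>f i\<close> only: components of \<open>g k\<close> outside the finite set
  \<open>H\<close> may be nonzero, but no \<open>f i\<close> with \<open>i \<in> F\<close> reads
  them.\<close>

lemma finite_class_injection:
  fixes A :: "'i \<Rightarrow> ('a, 'r) rmod" and B :: "'j \<Rightarrow> ('a, 'r) rmod"
  assumes R: "ring R" and mod: "\<And>M. M \<in> Ob \<Longrightarrow> right_module R M"
    and slender: "\<And>M. M \<in> Ob \<Longrightarrow> slender R M"
    and P: "completely_prime R Ob P" and Q: "completely_prime R Ob Q"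
    and aut: "\<And>M f. \<lbrakk>M \<in> Ob; f \<in> rhom R M M; f \<notin> P M M; f \<notin> Q M M\<rbrakk>
      \<Longrightarrow> bij_betw f (carrier M) (carrier M)"
    and A: "\<And>i. i \<in> I \<Longrightarrow> A i \<in> Ob" and B: "\<And>j. j \<in> J \<Longrightarrow> B j \<in> Ob"
    and nm: "\<not> measurable_set J"
    and iso: "rm_iso R (rprod I A) (rprod J B)"
    and F: "finite F" "F \<subseteq> I"
  shows "\<exists>s. inj_on s F \<and> s ` F \<subseteq> J \<and> (\<forall>i\<in>F. same_class R P (A i) (B (s i)))"
proof -
  interpret completely_prime_pair Ob "hom_group R" "\<lambda>M. compose (carrier M)" "\<lambda>M. \<lambda>x\<in>carrier M. x" P Q
    using mod P Q aut by (rule completely_prime_pair_rmod)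
  interpret A: module_family R I A by (rule module_family.intro) (use R mod A in auto)
  interpret B: module_family R J B by (rule module_family.intro) (use R mod B in auto)
  obtain \<phi> where \<phi>: "\<phi> \<in> rhom R A.prd B.prd" and bij: "bij_betw \<phi> (carrier A.prd) (carrier B.prd)"
    using iso unfolding rm_iso_def by blast
  define \<psi> where "\<psi> = restrict (inv_into (carrier A.prd) \<phi>) (carrier B.prd)"
  have \<psi>: "\<psi> \<in> rhom R B.prd A.prd"
    unfolding \<psi>_def by (rule inv_into_in_rhom[OF A.right_module_prd B.right_module_prd \<phi> bij])
  have \<psi>\<phi>: "\<psi> (\<phi> x) = x" if "x \<in> carrier A.prd" for x
    using that bij rhom_closed[OF \<phi> that] unfolding \<psi>_def bij_betw_def by (simp del: rprod_simps)
  define f where "f i = compose (carrier B.prd) (projection I A i) \<psi>" for i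
  define g where "g k = compose (carrier (A k)) \<phi> (insertion I A k)" for k
  have f: "f i \<in> rhom R B.prd (A i)" if "i \<in> I" for i
    unfolding f_def by (rule compose_in_rhom[OF B.right_module_prd \<psi> A.projection_in_rhom[OF that]])
  have g: "g k \<in> rhom R (A k) B.prd" if "k \<in> I" for k
    unfolding g_def by (rule compose_in_rhom[OF A.family[OF that] A.insertion_in_rhom[OF that] \<phi>])
  have fg: "f i (g k a) = (if i = k then a else rzero (A i))"
    if "i \<in> I" "k \<in> I" "a \<in> carrier (A k)" for i k a
  proof -
    have "insertion I A k a \<in> carrier A.prd" "g k a \<in> carrier B.prd"
      using rhom_closed[OF A.insertion_in_rhom] rhom_closed[OF g] that by blast+
    then show ?thesis
      using that \<psi>\<phi> by (simp add: f_def g_def compose_def projection_def del: rprod_simps)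
        (simp add: insertion_def)
  qed
  have st: "slender_target R J B (A i) (f i)" if "i \<in> I" for i
    using that A mod slender f
    by (intro slender_target.intro slender_target_axioms.intro B.module_family_axioms) auto
  have "\<exists>G. finite G \<and> G \<subseteq> J \<and> (\<forall>x\<in>carrier B.prd. f i x = f i (cutoff J B G x))" if "i \<in> I" for i
    using slender_target.factors_through_finite_subproduct[OF st[OF that] nm] .
  then obtain G where G: "\<And>i. i \<in> I \<Longrightarrow> finite (G i)" "\<And>i. i \<in> I \<Longrightarrow> G i \<subseteq> J"
    "\<And>i x. \<lbrakk>i \<in> I; x \<in> carrier B.prd\<rbrakk> \<Longrightarrow> f i x = f i (cutoff J B (G i) x)" by metis
  define H where "H = (\<Union>i\<in>F. G i)"
  have H: "finite H" "H \<subseteq> J" unfolding H_def using F G(1,2) by blast+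
  have fH: "f i (cutoff J B H x) = f i x" if i: "i \<in> F" and x: "x \<in> carrier B.prd" for i x
  proof -
    have iI: "i \<in> I" using F i by blast
    have "f i (cutoff J B H x) = f i (cutoff J B (G i) (cutoff J B H x))"
      using G(3)[OF iI B.cutoff_closed[OF x]] .
    also have "\<dots> = f i (cutoff J B (G i) x)"
      unfolding B.cutoff_cutoff using i H_def by (metis Int_absorb2 UN_upper)
    finally show ?thesis using G(3)[OF iI x] by simp
  qed
  define m where "m i j = compose (carrier (B j)) (f i) (insertion J B j)" for i j
  define n where "n j k = compose (carrier (A k)) (projection J B j) (g k)" for j k
  have sum: "(\<Oplus>\<^bsub>hom_group R (A k) (A i)\<^esub>j\<in>H. compose (carrier (A k)) (m i j) (n j k)) =
      (\<lambda>a\<in>carrier (A k). if i = k then a else rzero (A i))" if "i \<in> F" "k \<in> F" for i k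
  proof -
    have ik: "i \<in> I" "k \<in> I" using that F by auto
    have "(\<Oplus>\<^bsub>hom_group R (A k) (A i)\<^esub>j\<in>H. compose (carrier (A k)) (m i j) (n j k)) =
        (\<lambda>a\<in>carrier (A k). f i (cutoff J B H (g k a)))"
      unfolding m_def n_def
      by (rule slender_target.finsum_insertion_projection[OF st[OF ik(1)] A.family[OF ik(2)] g[OF ik(2)] H])
    then show ?thesis
      using fH[OF that(1)] rhom_closed[OF g[OF ik(2)]] fg[OF ik] by (simp cong: restrict_cong del: rprod_simps)
  qed
  \<comment> \<open>Here the matrix product is exactly the identity. The elimination lemma asks for
    this only modulo \<open>P\<close> because one elimination step already destroys
    exactness.\<close>
  have "\<exists>s. inj_on s F \<and> s ` F \<subseteq> H \<and> (\<forall>i\<in>F. equiv_mod (A i) (B (s i)))"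
  proof (rule injection_of_matrix_retract_mod[OF F(1) H(1), of A B m n])
    show "A \<in> F \<rightarrow> Ob" "B \<in> H \<rightarrow> Ob" using A B F H by auto
    show "m i j \<in> carrier (hom_group R (B j) (A i))" if "i \<in> F" "j \<in> H" for i j
      unfolding m_def hom_group_simps
      by (rule compose_in_rhom[OF B.family B.insertion_in_rhom f]) (use that F H in auto)
    show "n j k \<in> carrier (hom_group R (A k) (B j))" if "k \<in> F" "j \<in> H" for j k
      unfolding n_def hom_group_simps
      by (rule compose_in_rhom[OF A.family g B.projection_in_rhom]) (use that F H in auto)
    show "(\<Oplus>\<^bsub>hom_group R (A i) (A i)\<^esub>j\<in>H. compose (carrier (A i)) (m i j) (n j i))
        \<ominus>\<^bsub>hom_group R (A i) (A i)\<^esub> (\<lambda>x\<in>carrier (A i). x) \<in> P (A i) (A i)" if "i \<in> F" for i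
    proof -
      have Ai: "A i \<in> Ob" using A F that by blast
      interpret abelian_group "hom_group R (A i) (A i)" using Ai by (simp add: P.abelian_group_Hom)
      have "(\<lambda>x\<in>carrier (A i). x) \<ominus>\<^bsub>hom_group R (A i) (A i)\<^esub> (\<lambda>x\<in>carrier (A i). x) \<in> P (A i) (A i)"
        using P.ident_closed[OF Ai] P.zero_mem[OF Ai Ai] by (simp only: minus_eq r_neg)
      then show ?thesis using sum[OF that that] by simp
    qed
    show "(\<Oplus>\<^bsub>hom_group R (A k) (A i)\<^esub>j\<in>H. compose (carrier (A k)) (m i j) (n j k)) \<in> P (A k) (A i)"
      if "i \<in> F" "k \<in> F" "i \<noteq> k" for i k
      using sum[OF that(1,2)] that P.zero_mem[of "A k" "A i"] A F by (auto simp: hom_zero_def)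
  qed
  then show ?thesis using H unfolding same_class_def hom_group_simps by blast
qed

section \<open>Bijections between classes\<close>

text \<open>Either both sets are finite, and the injections of the whole sets compare their
  cardinalities, or both are infinite, and countability makes both equipotent with the natural
  numbers.\<close>

lemma bij_betw_of_finite_injections:
  assumes "countable S" "countable T"
    and ST: "\<And>F. \<lbrakk>finite F; F \<subseteq> S\<rbrakk> \<Longrightarrow> \<exists>s. inj_on s F \<and> s ` F \<subseteq> T"
    and TS: "\<And>F. \<lbrakk>finite F; F \<subseteq> T\<rbrakk> \<Longrightarrow> \<exists>s. inj_on s F \<and> s ` F \<subseteq> S"
  shows "\<exists>\<beta>. bij_betw \<beta> S T"
proof -
  have small: "finite S" if "finite T"
    and inj: "\<And>F. \<lbrakk>finite F; F \<subseteq> S\<rbrakk> \<Longrightarrow> \<exists>s. inj_on s F \<and> s ` F \<subseteq> T" for S :: "'x set" and T :: "'y set"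
  proof (rule ccontr)
    assume "infinite S"
    then obtain F where F: "finite F" "F \<subseteq> S" "card F = Suc (card T)"
      using infinite_arbitrarily_large by blast
    then obtain s where "inj_on s F" "s ` F \<subseteq> T" using inj by blast
    then show False using card_inj_on_le[of s F T] F that(1) by simp
  qed
  show ?thesis
  proof (cases "finite S")
    case True
    then have "finite T" using small[of S T] TS by blast
    moreover have "card S \<le> card T" "card T \<le> card S"
      using ST[OF True order_refl] TS[OF \<open>finite T\<close> order_refl] card_inj_on_le True \<open>finite T\<close> by blast+
    ultimately show ?thesis using True finite_same_card_bij by (metis order_antisym)
  next
    case False
    then have "infinite T" using small[of T S] ST by blast
    then have "bij_betw (from_nat_into T \<circ> to_nat_on S) S T"
      using assms(1,2) False
      by (intro bij_betw_trans[OF to_nat_on_infinite bij_betw_from_nat_into])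
    then show ?thesis by blast
  qed
qed

text \<open>The finite matchings respect classes, so they restrict to each class and yield a
  bijection there. The classes partition both \<open>I\<close> and \<open>J\<close>, so these
  bijections glue.\<close>

lemma class_bijection:
  assumes sym: "\<And>x y. E x y \<Longrightarrow> E y x"
    and trans: "\<And>x y z. \<lbrakk>x \<in> X; y \<in> X; z \<in> X; E x y; E y z\<rbrakk> \<Longrightarrow> E x z"
    and refl: "\<And>x. x \<in> X \<Longrightarrow> E x x"
    and a: "\<And>i. i \<in> I \<Longrightarrow> a i \<in> X" and b: "\<And>j. j \<in> J \<Longrightarrow> b j \<in> X"
    and cnt: "\<And>x. x \<in> X \<Longrightarrow> countable {i\<in>I. E x (a i)} \<and> countable {j\<in>J. E x (b j)}"
    and IJ: "\<And>F. \<lbrakk>finite F; F \<subseteq> I\<rbrakk> \<Longrightarrow> \<exists>s. inj_on s F \<and> s ` F \<subseteq> J \<and> (\<forall>i\<in>F. E (a i) (b (s i)))"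
    and JI: "\<And>F. \<lbrakk>finite F; F \<subseteq> J\<rbrakk> \<Longrightarrow> \<exists>s. inj_on s F \<and> s ` F \<subseteq> I \<and> (\<forall>j\<in>F. E (b j) (a (s j)))"
  shows "\<exists>\<sigma>. bij_betw \<sigma> I J \<and> (\<forall>i\<in>I. E (a i) (b (\<sigma> i)))"
proof -
  define cI where "cI x = {i\<in>I. E x (a i)}" for x
  define cJ where "cJ x = {j\<in>J. E x (b j)}" for x
  have ex: "\<exists>\<beta>. bij_betw \<beta> (cI x) (cJ x)" if x: "x \<in> X" for x
  proof (rule bij_betw_of_finite_injections)
    show "countable (cI x)" "countable (cJ x)" using cnt[OF x] by (simp_all add: cI_def cJ_def)
    show "\<exists>s. inj_on s F \<and> s ` F \<subseteq> cJ x" if F: "finite F" "F \<subseteq> cI x" for F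
    proof -
      obtain s where s: "inj_on s F" "s ` F \<subseteq> J" "\<forall>i\<in>F. E (a i) (b (s i))"
        using IJ[of F] F unfolding cI_def by blast
      have "E x (b (s i))" if "i \<in> F" for i
        using trans[of x "a i" "b (s i)"] a b s that \<open>F \<subseteq> cI x\<close> x unfolding cI_def by blast
      then show ?thesis using s unfolding cJ_def by blast
    qed
    show "\<exists>s. inj_on s F \<and> s ` F \<subseteq> cI x" if F: "finite F" "F \<subseteq> cJ x" for F
    proof -
      obtain s where s: "inj_on s F" "s ` F \<subseteq> I" "\<forall>i\<in>F. E (b i) (a (s i))"
        using JI[of F] F unfolding cJ_def by blast
      have "E x (a (s i))" if "i \<in> F" for i
        using trans[of x "b i" "a (s i)"] a b s that \<open>F \<subseteq> cJ x\<close> x unfolding cJ_def by blast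
      then show ?thesis using s unfolding cI_def by blast
    qed
  qed
  \<comment> \<open>\<open>\<beta> x\<close> depends on \<open>x\<close> only through \<open>cI x\<close> and \<open>cJ x\<close>, hence only on the class of \<open>x\<close>.\<close>
  define \<beta> where "\<beta> x = (SOME \<beta>. bij_betw \<beta> (cI x) (cJ x))" for x
  have \<beta>: "bij_betw (\<beta> x) (cI x) (cJ x)" if "x \<in> X" for x
    unfolding \<beta>_def using someI_ex[OF ex[OF that]] .
  have same: "cI x = cI y" "cJ x = cJ y" if "x \<in> X" "y \<in> X" "E x y" for x y
    using that a b trans sym unfolding cI_def cJ_def by blast+
  then have \<beta>_same: "\<beta> x = \<beta> y" if "x \<in> X" "y \<in> X" "E x y" for x y
    using that unfolding \<beta>_def by simp
  define \<sigma> where "\<sigma> i = \<beta> (a i) i" for i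
  have ci: "i \<in> cI (a i)" if "i \<in> I" for i using that a refl by (simp add: cI_def)
  have \<sigma>: "\<sigma> i \<in> cJ (a i)" if "i \<in> I" for i
    unfolding \<sigma>_def using bij_betwE[OF \<beta>[OF a[OF that]]] ci[OF that] by blast
  have "bij_betw \<sigma> I J"
    unfolding bij_betw_def
  proof
    show "inj_on \<sigma> I"
    proof (rule inj_onI)
      fix i k assume ik: "i \<in> I" "k \<in> I" "\<sigma> i = \<sigma> k"
      have "\<sigma> i \<in> J" "E (a i) (b (\<sigma> i))" "E (a k) (b (\<sigma> i))"
        using \<sigma>[OF ik(1)] \<sigma>[OF ik(2)] ik(3) unfolding cJ_def by simp_all
      \<comment> \<open>A common image links the two indices through the same \<open>b\<close>, so
        both are handled by one injective \<open>\<beta>\<close>.\<close>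
      then have E: "E (a i) (a k)" using trans[of "a i" "b (\<sigma> i)" "a k"] sym a b ik by blast
      then have "\<beta> (a i) i = \<beta> (a i) k" using ik \<beta>_same a unfolding \<sigma>_def by metis
      moreover have "k \<in> cI (a i)" using E ik unfolding cI_def by blast
      ultimately show "i = k"
        using bij_betw_imp_inj_on[OF \<beta>[OF a[OF ik(1)]]] ci[OF ik(1)] by (auto dest: inj_onD)
    qed
    show "\<sigma> ` I = J"
    proof
      show "\<sigma> ` I \<subseteq> J" using \<sigma> unfolding cJ_def by blast
      show "J \<subseteq> \<sigma> ` I"
      proof
        fix j assume j: "j \<in> J"
        then have "j \<in> cJ (b j)" using refl b unfolding cJ_def by blast
        then have "j \<in> \<beta> (b j) ` cI (b j)"
          using bij_betw_imp_surj_on[OF \<beta>[OF b[OF j]]] by simp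
        then obtain i where i: "i \<in> cI (b j)" "\<beta> (b j) i = j" by (elim imageE) simp
        then have "i \<in> I" "E (b j) (a i)" unfolding cI_def by auto
        then have "\<sigma> i = j" using \<beta>_same[of "b j" "a i"] a b j i unfolding \<sigma>_def by simp
        then show "j \<in> \<sigma> ` I" using \<open>i \<in> I\<close> by blast
      qed
    qed
  qed
  moreover have "E (a i) (b (\<sigma> i))" if "i \<in> I" for i using \<sigma>[OF that] unfolding cJ_def by blast
  ultimately show ?thesis by blast
qed

text \<open>This is primality: the composite of two morphisms outside the ideal is again outside
  it.\<close>

lemma same_class_trans:
  assumes P: "completely_prime R Ob P" and mod: "\<And>M. M \<in> Ob \<Longrightarrow> right_module R M"
    and ob: "X \<in> Ob" "Y \<in> Ob" "Z \<in> Ob" and "same_class R P X Y" "same_class R P Y Z"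
  shows "same_class R P X Z"
proof -
  have sub: "P M N \<subseteq> rhom R M N" if "M \<in> Ob" "N \<in> Ob" for M N
    using P that unfolding completely_prime_def by blast
  have step: "P L N \<noteq> rhom R L N"
    if ob: "L \<in> Ob" "M \<in> Ob" "N \<in> Ob" and ne: "P L M \<noteq> rhom R L M" "P M N \<noteq> rhom R M N" for L M N
  proof -
    obtain f g where "f \<in> rhom R L M" "f \<notin> P L M" "g \<in> rhom R M N" "g \<notin> P M N"
      using sub ob ne by blast
    then show ?thesis
      using P ob compose_in_rhom[OF mod[OF ob(1)]] unfolding completely_prime_def by blast
  qed
  show ?thesis using assms(6,7) step ob unfolding same_class_def by blast
qed

lemma rm_iso_sym:
  assumes "right_module R M" "right_module R N" "rm_iso R M N"
  shows "rm_iso R N M"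
proof -
  obtain f where f: "f \<in> rhom R M N" "bij_betw f (carrier M) (carrier N)"
    using assms(3) unfolding rm_iso_def by blast
  have "bij_betw (restrict (inv_into (carrier M) f) (carrier N)) (carrier N) (carrier M)"
    using bij_betw_inv_into[OF f(2)] by (simp cong: bij_betw_cong)
  then show ?thesis unfolding rm_iso_def using inv_into_in_rhom[OF assms(1,2) f] by blast
qed

text \<open>The conclusion concerns \<open>P\<close> alone, with \<open>Q\<close> entering through
  the automorphism criterion. The criterion is symmetric, so exchanging the two ideals gives the
  second bijection.\<close>

lemma prime_class_bijection:
  fixes A :: "'i \<Rightarrow> ('a, 'r) rmod" and B :: "'j \<Rightarrow> ('a, 'r) rmod"
  assumes R: "ring R" and mod: "\<And>M. M \<in> Ob \<Longrightarrow> right_module R M"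
    and slender: "\<And>M. M \<in> Ob \<Longrightarrow> slender R M"
    and P: "completely_prime R Ob P" and Q: "completely_prime R Ob Q"
    and aut: "\<And>M f. \<lbrakk>M \<in> Ob; f \<in> rhom R M M; f \<notin> P M M; f \<notin> Q M M\<rbrakk>
      \<Longrightarrow> bij_betw f (carrier M) (carrier M)"
    and A: "\<And>i. i \<in> I \<Longrightarrow> A i \<in> Ob" and B: "\<And>j. j \<in> J \<Longrightarrow> B j \<in> Ob"
    and nm: "\<not> measurable_set I" "\<not> measurable_set J"
    and cnt: "\<And>X. X \<in> Ob \<Longrightarrow>
      countable {i\<in>I. same_class R P X (A i)} \<and> countable {j\<in>J. same_class R P X (B j)}"
    and iso: "rm_iso R (rprod I A) (rprod J B)"
  shows "\<exists>\<sigma>. bij_betw \<sigma> I J \<and> (\<forall>i\<in>I. same_class R P (A i) (B (\<sigma> i)))"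
proof (rule class_bijection[where X = Ob])
  have iso': "rm_iso R (rprod J B) (rprod I A)"
    using R mod A B by (intro rm_iso_sym[OF _ _ iso] right_module_rprod) auto
  show "\<exists>s. inj_on s F \<and> s ` F \<subseteq> I \<and> (\<forall>j\<in>F. same_class R P (B j) (A (s j)))"
    if "finite F" "F \<subseteq> J" for F
    by (rule finite_class_injection[where Ob = Ob and Q = Q]) (fact R mod slender P Q aut A B nm iso' that)+
  show "\<exists>s. inj_on s F \<and> s ` F \<subseteq> J \<and> (\<forall>i\<in>F. same_class R P (A i) (B (s i)))"
    if "finite F" "F \<subseteq> I" for F
    by (rule finite_class_injection[where Ob = Ob and Q = Q]) (fact R mod slender P Q aut A B nm iso that)+
  show "same_class R P X Z" if "X \<in> Ob" "Y \<in> Ob" "Z \<in> Ob" "same_class R P X Y" "same_class R P Y Z"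
    for X Y Z using same_class_trans[OF P mod that] by blast
  show "same_class R P X X" if "X \<in> Ob" for X
    using P that unfolding same_class_def completely_prime_def by blast
qed (use A B cnt in \<open>auto simp: same_class_def\<close>)

theorem theorem5p3:
  fixes R :: "'r ring"
    and Ob :: "('a, 'r) rmod set"
    and P Q :: "('a, 'r) rmod \<Rightarrow> ('a, 'r) rmod \<Rightarrow> ('a \<Rightarrow> 'a) set"
    and I :: "'i set" and J :: "'j set"
    and A :: "'i \<Rightarrow> ('a, 'r) rmod" and B :: "'j \<Rightarrow> ('a, 'r) rmod"
  assumes "ring R"
    and "\<forall>M\<in>Ob. right_module R M \<and> indecomposable R M \<and> slender R M"
    and "completely_prime R Ob P" and "completely_prime R Ob Q"
    and "\<forall>M\<in>Ob. \<forall>f\<in>rhom R M M.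
           bij_betw f (carrier M) (carrier M) \<longleftrightarrow> f \<notin> P M M \<union> Q M M"
    and "DSP R Ob"
    and "\<forall>i\<in>I. A i \<in> Ob" and "\<forall>j\<in>J. B j \<in> Ob"
    and "\<not> measurable_set I" and "\<not> measurable_set J"
    and "\<forall>X\<in>Ob. countable {i\<in>I. same_class R P X (A i)} \<and> countable {j\<in>J. same_class R P X (B j)}"
    and "\<forall>X\<in>Ob. countable {i\<in>I. same_class R Q X (A i)} \<and> countable {j\<in>J. same_class R Q X (B j)}"
    and "rm_iso R (rprod I A) (rprod J B)"
  shows "\<exists>\<sigma> \<tau>. bij_betw \<sigma> I J \<and> bij_betw \<tau> I J \<and>
           (\<forall>i\<in>I. same_class R P (A i) (B (\<sigma> i)) \<and> same_class R Q (A i) (B (\<tau> i)))"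
proof -
  have "\<exists>\<sigma>. bij_betw \<sigma> I J \<and> (\<forall>i\<in>I. same_class R P (A i) (B (\<sigma> i)))"
    by (rule prime_class_bijection[where Ob = Ob and Q = Q]) (use assms in simp_all)
  moreover have "\<exists>\<tau>. bij_betw \<tau> I J \<and> (\<forall>i\<in>I. same_class R Q (A i) (B (\<tau> i)))"
    by (rule prime_class_bijection[where Ob = Ob and Q = P]) (use assms in simp_all)
  ultimately show ?thesis by blast
qed

end
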